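(* Let $\boldsymbol v$ be the elastic scattered field, let $\boldsymbol v_N$ be its truncated Fourier–Bessel expansion, and let $\boldsymbol v_N^\delta$ be the truncated expansion computed from noisy data $\boldsymbol v^\delta\in(L^2(\Gamma_\rho))^2$ satisfying $\|\boldsymbol v-\boldsymbol v^\delta\|_{(L^2(\Gamma_\rho))^2}\le\delta\|\boldsymbol v\|_{(L^2(\Gamma_\rho))^2}$ with noise level $\delta\in(0,1)$. Assume that the truncation order satisfies $N\ge N_0:=4k_s\rho+1$. Then there exist constants $C_3,C_4>0$ such that $$\|\boldsymbol v_N-\boldsymbol v_N^\delta\|^2_{(L^2(\Gamma_\rho))^2}\le C_3\delta^2+C_4N^5\delta^2 .$$
   Context: Scattering problem. $D\subset\mathbb R^2$ is a bounded simply connected domain with $C^2$ boundary, $\rho>0$, $B_\rho=\{x\in\mathbb R^2:|x|<\rho\}$, $\Gamma_\rho=\partial B_\rho$, $D\subset B_\rho$, and $B_\rho\setminus\overline D$ is connected. The Lamé constants satisfy $\mu>0$, $\lambda+\mu>0$; $\omega>0$; $k_p=\omega/\sqrt{\lambda+2\mu}$, $k_s=\omega/\sqrt\mu$; $\Delta^*\boldsymbol u=\mu\Delta\boldsymbol u+(\lambda+\mu)\nabla\nabla\cdot\boldsymbol u$. Fix a source point $z\in\Gamma_\rho$ and a polarization $\boldsymbol p\in\mathbb S=\{x\in\mathbb R^2:|x|=1\}$. The incident field is $\boldsymbol u^i(x)=\mathbb G(x,z)\boldsymbol p$, with $\mathbb G(x,y)=\frac1\mu\Phi_s(x,y)\mathbb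 I+\frac1{\omega^2}\nabla_x\nabla_x^\top(\Phi_s(x,y)-\Phi_p(x,y))$, where $\mathbb I$ is the $2\times2$ identity matrix, $\Phi_\xi(x,y)=\frac{\mathrm i}{4}H_0^{(1)}(k_\xi|x-y|)$ for $\xi\in\{p,s\}$, and $H_n^{(1)}$ is the Hankel function of the first kind of order $n$. The scattered field $\boldsymbol v$ satisfies $\Delta^*\boldsymbol v+\omega^2\boldsymbol v=0$ in $\mathbb R^2\setminus\overline D$, $\boldsymbol u:=\boldsymbol u^i+\boldsymbol v=0$ on $\partial D$, and the Kupradze–Sommerfeld radiation condition $\lim_{r\to\infty}\sqrt r(\partial_r\boldsymbol v_\xi-\mathrm ik_\xi\boldsymbol v_\xi)=0$, $\xi\in\{p,s\}$, $r=|x|$, where $\boldsymbol v_p=-k_p^{-2}\,\mathrm{grad}\,\mathrm{div}\,\boldsymbol v$, $\boldsymbol v_s=-k_s^{-2}\,\mathrm{grad}^\perp\mathrm{div}^\perp\boldsymbol v$, $\mathrm{grad}^\perp=(-\partial_2,\partial_1)^\top$, $\mathrm{div}^\perp=(-\partial_2,\partial_1)$. Expansion. Write $\boldsymbol v=\nabla\phi_p+\mathbf{curl}\,\phi_s$ with scalar potentials $\phi_\xi$ satisfying $\Delta\phi_\xi+k_\xi^2\phi_\xi=0$ and the Sommerfeld radiation condition $\lim_{r\to\infty}\sqrt r(\partial_r\phi_\xi-\mathrm ik_\xi\phi_\xi)=0$; in polar coordinates $(r,\theta)$, $\mathbf{curl}\,w=\frac1r\partial_\theta w\,\boldsymbol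 e_r-\partial_r w\,\boldsymbol e_\theta$, with $\boldsymbol e_r=(\cos\theta,\sin\theta)^\top$, $\boldsymbol e_\theta=(-\sin\theta,\cos\theta)^\top$. Fix $R>0$ with $B_R=\{x\in\mathbb R^2:|x|<R\}\subset D$. As part of the setting, the potentials are expanded outside $B_R$ as $\phi_\xi=\sum_{n\in\mathbb Z}\frac{H_n^{(1)}(k_\xi r)}{H_n^{(1)}(k_\xi R)}\hat\phi_{\xi,n}\mathrm e^{\mathrm in\theta}$, $\xi\in\{p,s\}$, with Fourier coefficients $\hat\phi_{\xi,n}$. Notation: $\boldsymbol U_n(\theta)=\mathrm e^{\mathrm in\theta}\boldsymbol e_r$, $\boldsymbol V_n(\theta)=\mathrm e^{\mathrm in\theta}\boldsymbol e_\theta$, $\alpha_{\xi,n}(r)=\frac{k_\xi H_n^{(1)\prime}(k_\xi r)}{H_n^{(1)}(k_\xi R)}$, $\beta_{\xi,n}(r)=\frac{H_n^{(1)}(k_\xi r)}{H_n^{(1)}(k_\xi R)}$, and $\alpha_{\xi,n}=\alpha_{\xi,n}(\rho)$, $\beta_{\xi,n}=\beta_{\xi,n}(\rho)$; it is assumed that $H_n^{(1)}(k_\xi\rho)\neq0$. Then $$\boldsymbol v_N(x)=\sum_{n=-N}^{N}\Big[\Big(\alpha_{p,n}(r)\hat\phi_{p,n}+\tfrac{\mathrm i n}{r}\beta_{s,n}(r)\hat\phi_{s,n}\Big)\boldsymbol U_n(\theta)+\Big(\tfrac{\mathrm i n}{r}\beta_{p,n}(r)\hat\phi_{p,n}-\alpha_{s,n}(r)\hat\phi_{s,n}\Big)\boldsymbol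 V_n(\theta)\Big],$$ and $\boldsymbol v$ is given by the same series over all $n\in\mathbb Z$. The coefficients solve $$\begin{bmatrix}\alpha_{p,n}&\frac{\mathrm in}{\rho}\beta_{s,n}\\ \frac{\mathrm in}{\rho}\beta_{p,n}&-\alpha_{s,n}\end{bmatrix}\begin{bmatrix}\hat\phi_{p,n}\\ \hat\phi_{s,n}\end{bmatrix}=\begin{bmatrix}f_{p,n}\\ f_{s,n}\end{bmatrix},\quad f_{p,n}=\frac1{2\pi\rho}\int_{\Gamma_\rho}\boldsymbol v\cdot\overline{\boldsymbol U_n}\,\mathrm ds,\quad f_{s,n}=\frac1{2\pi\rho}\int_{\Gamma_\rho}\boldsymbol v\cdot\overline{\boldsymbol V_n}\,\mathrm ds .$$ This system is uniquely solvable for every $n\in\mathbb Z$, since it is known that $\Lambda_n=\frac{n^2}{\rho^2}-\frac{\alpha_{p,n}\alpha_{s,n}}{\beta_{p,n}\beta_{s,n}}\ne0$. Noisy version. $\hat\phi^\delta_{p,n},\hat\phi^\delta_{s,n}$ solve the same system with $\boldsymbol v$ replaced by $\boldsymbol v^\delta$ in the right-hand side, and $\boldsymbol v_N^\delta$ is defined by the formula for $\boldsymbol v_N$ with $\hat\phi_{\xi,n}$ replaced by $\hat\phi_{\xi,n}^\delta$. *)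

theory Defs
  imports "HOL-Analysis.Analysis"
begin

definition bessel_J :: "nat \<Rightarrow> complex \<Rightarrow> complex" where
  "bessel_J n w = (\<Sum>m. (- 1) ^ m / (fact m * fact (m + n)) * (w / 2) ^ (2 * m + n))"

text \<open>The standard series of the Bessel function of the second kind at integer order,
  with the principal branch of the logarithm (DLMF 10.8.1).\<close>
definition bessel_Y :: "nat \<Rightarrow> complex \<Rightarrow> complex" where
  "bessel_Y n w =
     2 / of_real pi * Ln (w / 2) * bessel_J n w
     - 1 / of_real pi * (\<Sum>k<n. fact (n - k - 1) / fact k * (w / 2) ^ (2 * k) / (w / 2) ^ n)
     - 1 / of_real pi * (\<Sum>k. (Digamma (of_nat (k + 1)) + Digamma (of_nat (n + k + 1)))
                              * (- 1) ^ k / (fact k * fact (n + k)) * (w / 2) ^ (2 * k + n))"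

text \<open>The sign accounts for \<open>J\<^bsub>-n\<^esub> = (-1)\<^sup>n J\<^sub>n\<close> and \<open>Y\<^bsub>-n\<^esub> = (-1)\<^sup>n Y\<^sub>n\<close>.\<close>
definition hankel1 :: "int \<Rightarrow> complex \<Rightarrow> complex" where
  "hankel1 n w = (if n < 0 then (- 1) ^ nat \<bar>n\<bar> else 1)
     * (bessel_J (nat \<bar>n\<bar>) w + \<i> * bessel_Y (nat \<bar>n\<bar>) w)"

definition pd :: "2 \<Rightarrow> (real^2 \<Rightarrow> 'a::real_normed_vector) \<Rightarrow> real^2 \<Rightarrow> 'a" where
  "pd i f x = frechet_derivative f (at x) (axis i 1)"

definition C2_on :: "(real^2) set \<Rightarrow> (real^2 \<Rightarrow> 'a::real_normed_vector) \<Rightarrow> bool" where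
  "C2_on S f \<longleftrightarrow> (\<forall>x\<in>S. f differentiable (at x)) \<and>
     (\<forall>i. \<forall>x\<in>S. pd i f differentiable (at x)) \<and>
     (\<forall>i j. continuous_on S (pd i (pd j f)))"

definition laplacian :: "(real^2 \<Rightarrow> 'a::real_normed_vector) \<Rightarrow> real^2 \<Rightarrow> 'a" where
  "laplacian f x = (\<Sum>i\<in>UNIV. pd i (pd i f) x)"

definition grad :: "(real^2 \<Rightarrow> complex) \<Rightarrow> real^2 \<Rightarrow> complex^2" where
  "grad f x = (\<chi> i. pd i f x)"

definition divg :: "(real^2 \<Rightarrow> complex^2) \<Rightarrow> real^2 \<Rightarrow> complex" where
  "divg w x = (\<Sum>i\<in>UNIV. pd i (\<lambda>y. w y $ i) x)"

definition grad_perp :: "(real^2 \<Rightarrow> complex) \<Rightarrow> real^2 \<Rightarrow> complex^2" where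
  "grad_perp f x = vector [- pd 2 f x, pd 1 f x]"

definition div_perp :: "(real^2 \<Rightarrow> complex^2) \<Rightarrow> real^2 \<Rightarrow> complex" where
  "div_perp w x = - pd 2 (\<lambda>y. w y $ 1) x + pd 1 (\<lambda>y. w y $ 2) x"

definition polar_pt :: "real \<Rightarrow> real \<Rightarrow> real^2" where
  "polar_pt r \<theta> = vector [r * cos \<theta>, r * sin \<theta>]"

definition polar_angle :: "real^2 \<Rightarrow> real" where
  "polar_angle x = Arg (Complex (x $ 1) (x $ 2))"

definition e_r :: "real \<Rightarrow> complex^2" where
  "e_r \<theta> = vector [of_real (cos \<theta>), of_real (sin \<theta>)]"

definition e_theta :: "real \<Rightarrow> complex^2" where
  "e_theta \<theta> = vector [of_real (- sin \<theta>), of_real (cos \<theta>)]"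

definition radial_deriv :: "(real^2 \<Rightarrow> 'a::real_normed_vector) \<Rightarrow> real^2 \<Rightarrow> 'a" where
  "radial_deriv f x =
     vector_derivative (\<lambda>r. f (polar_pt r (polar_angle x))) (at (norm x))"

definition angular_deriv :: "(real^2 \<Rightarrow> 'a::real_normed_vector) \<Rightarrow> real^2 \<Rightarrow> 'a" where
  "angular_deriv f x =
     vector_derivative (\<lambda>\<theta>. f (polar_pt (norm x) \<theta>)) (at (polar_angle x))"

definition curl_pol :: "(real^2 \<Rightarrow> complex) \<Rightarrow> real^2 \<Rightarrow> complex^2" where
  "curl_pol w x = (angular_deriv w x / of_real (norm x)) *s e_r (polar_angle x)
                  - radial_deriv w x *s e_theta (polar_angle x)"

text \<open>The limit is taken along \<open>at_infinity\<close>, i.e. uniformly in all directions.\<close>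
definition sommerfeld :: "real \<Rightarrow> (real^2 \<Rightarrow> complex) \<Rightarrow> bool" where
  "sommerfeld k f \<longleftrightarrow>
     ((\<lambda>x. of_real (sqrt (norm x)) * (radial_deriv f x - \<i> * of_real k * f x)) \<longlongrightarrow> 0) at_infinity"

definition sommerfeld_vec :: "real \<Rightarrow> (real^2 \<Rightarrow> complex^2) \<Rightarrow> bool" where
  "sommerfeld_vec k w \<longleftrightarrow>
     ((\<lambda>x. of_real (sqrt (norm x)) *s (radial_deriv w x - (\<i> * of_real k) *s w x)) \<longlongrightarrow> 0) at_infinity"

definition C2_real :: "(real \<Rightarrow> real) \<Rightarrow> bool" where
  "C2_real g \<longleftrightarrow> (\<exists>g' g''. (\<forall>t. (g has_real_derivative g' t) (at t)) \<and>
     (\<forall>t. (g' has_real_derivative g'' t) (at t)) \<and> continuous_on UNIV g'')"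

text \<open>Near each of its boundary points the set is, after an orthogonal change of coordinates,
  the region above the graph of a \<open>C\<^sup>2\<close> function.\<close>
definition C2_boundary :: "(real^2) set \<Rightarrow> bool" where
  "C2_boundary D \<longleftrightarrow> (\<forall>x0\<in>frontier D. \<exists>\<epsilon>>0. \<exists>(T :: real^2 \<Rightarrow> real^2) g. orthogonal_transformation T \<and> C2_real g \<and>
     D \<inter> ball x0 \<epsilon> = {x \<in> ball x0 \<epsilon>. T x $ 2 > g (T x $ 1)})"

definition obstacle :: "real \<Rightarrow> (real^2) set \<Rightarrow> bool" where
  "obstacle \<rho> D \<longleftrightarrow> open D \<and> connected D \<and> D \<noteq> {} \<and> bounded D \<and> simply_connected D \<and>
     C2_boundary D \<and> D \<subseteq> ball 0 \<rho> \<and> connected (ball 0 \<rho> - closure D)"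

definition k_p :: "real \<Rightarrow> real \<Rightarrow> real \<Rightarrow> real" where
  "k_p lam mu \<omega> = \<omega> / sqrt (lam + 2 * mu)"

definition k_s :: "real \<Rightarrow> real \<Rightarrow> real" where
  "k_s mu \<omega> = \<omega> / sqrt mu"

definition lame_op :: "real \<Rightarrow> real \<Rightarrow> (real^2 \<Rightarrow> complex^2) \<Rightarrow> real^2 \<Rightarrow> complex^2" where
  "lame_op lam mu w x = mu *\<^sub>R laplacian w x + (lam + mu) *\<^sub>R grad (divg w) x"

definition fund_helmholtz :: "real \<Rightarrow> real^2 \<Rightarrow> real^2 \<Rightarrow> complex" where
  "fund_helmholtz k x y = \<i> / 4 * hankel1 0 (of_real (k * norm (x - y)))"

definition green_tensor :: "real \<Rightarrow> real \<Rightarrow> real \<Rightarrow> real^2 \<Rightarrow> real^2 \<Rightarrow> complex^2^2" where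
  "green_tensor lam mu \<omega> x y = (\<chi> i j.
     of_real (1 / mu) * fund_helmholtz (k_s mu \<omega>) x y * (if i = j then 1 else 0)
     + of_real (1 / \<omega>\<^sup>2) *
       pd i (pd j (\<lambda>x'. fund_helmholtz (k_s mu \<omega>) x' y - fund_helmholtz (k_p lam mu \<omega>) x' y)) x)"

definition incident_field ::
  "real \<Rightarrow> real \<Rightarrow> real \<Rightarrow> real^2 \<Rightarrow> real^2 \<Rightarrow> real^2 \<Rightarrow> complex^2" where
  "incident_field lam mu \<omega> z p x = green_tensor lam mu \<omega> x z *v (\<chi> i. of_real (p $ i))"

definition p_part :: "real \<Rightarrow> (real^2 \<Rightarrow> complex^2) \<Rightarrow> real^2 \<Rightarrow> complex^2" where
  "p_part kp v x = - (1 / kp\<^sup>2) *\<^sub>R grad (divg v) x"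

definition s_part :: "real \<Rightarrow> (real^2 \<Rightarrow> complex^2) \<Rightarrow> real^2 \<Rightarrow> complex^2" where
  "s_part ks v x = - (1 / ks\<^sup>2) *\<^sub>R grad_perp (div_perp v) x"

text \<open>Classical solution of the exterior Dirichlet problem: twice continuously differentiable
  outside \<open>closure D\<close> and continuous up to the boundary.\<close>
definition scattered_field ::
  "real \<Rightarrow> real \<Rightarrow> real \<Rightarrow> (real^2) set \<Rightarrow> real^2 \<Rightarrow> real^2 \<Rightarrow> (real^2 \<Rightarrow> complex^2) \<Rightarrow> bool" where
  "scattered_field lam mu \<omega> D z p v \<longleftrightarrow>
     C2_on (- closure D) v \<and> continuous_on (- D) v \<and>
     (\<forall>x. x \<notin> closure D \<longrightarrow> lame_op lam mu v x + \<omega>\<^sup>2 *\<^sub>R v x = 0) \<and>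
     (\<forall>x\<in>frontier D. incident_field lam mu \<omega> z p x + v x = 0) \<and>
     sommerfeld_vec (k_p lam mu \<omega>) (p_part (k_p lam mu \<omega>) v) \<and>
     sommerfeld_vec (k_s mu \<omega>) (s_part (k_s mu \<omega>) v)"

definition radiating_potential :: "real \<Rightarrow> (real^2) set \<Rightarrow> (real^2 \<Rightarrow> complex) \<Rightarrow> bool" where
  "radiating_potential k D \<phi> \<longleftrightarrow> C2_on (- closure D) \<phi> \<and>
     (\<forall>x. x \<notin> closure D \<longrightarrow> laplacian \<phi> x + of_real (k\<^sup>2) * \<phi> x = 0) \<and> sommerfeld k \<phi>"

definition alpha :: "real \<Rightarrow> real \<Rightarrow> int \<Rightarrow> real \<Rightarrow> complex" where
  "alpha k R n r = of_real k * deriv (hankel1 n) (of_real (k * r)) / hankel1 n (of_real (k * R))"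

definition beta :: "real \<Rightarrow> real \<Rightarrow> int \<Rightarrow> real \<Rightarrow> complex" where
  "beta k R n r = hankel1 n (of_real (k * r)) / hankel1 n (of_real (k * R))"

definition hankel_expansion ::
  "real \<Rightarrow> real \<Rightarrow> (real^2 \<Rightarrow> complex) \<Rightarrow> (int \<Rightarrow> complex) \<Rightarrow> bool" where
  "hankel_expansion k R \<phi> c \<longleftrightarrow> (\<forall>r>R. \<forall>\<theta>.
     ((\<lambda>n. hankel1 n (of_real (k * r)) / hankel1 n (of_real (k * R)) * c n
           * exp (\<i> * of_int n * of_real \<theta>)) has_sum \<phi> (polar_pt r \<theta>)) UNIV)"

definition U :: "int \<Rightarrow> real \<Rightarrow> complex^2" where
  "U n \<theta> = exp (\<i> * of_int n * of_real \<theta>) *s e_r \<theta>"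

definition V :: "int \<Rightarrow> real \<Rightarrow> complex^2" where
  "V n \<theta> = exp (\<i> * of_int n * of_real \<theta>) *s e_theta \<theta>"

definition truncated_field ::
  "real \<Rightarrow> real \<Rightarrow> real \<Rightarrow> (int \<Rightarrow> complex) \<Rightarrow> (int \<Rightarrow> complex) \<Rightarrow> nat \<Rightarrow> real^2 \<Rightarrow> complex^2" where
  "truncated_field kp ks R cp cs N x =
     (let r = norm x; \<theta> = polar_angle x in
      \<Sum>n = - int N..int N.
        (alpha kp R n r * cp n + \<i> * of_int n / of_real r * beta ks R n r * cs n) *s U n \<theta>
        + (\<i> * of_int n / of_real r * beta kp R n r * cp n - alpha ks R n r * cs n) *s V n \<theta>)"

text \<open>Integration over the circle of radius \<open>\<rho>\<close> is expressed through the arc length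
  parametrisation \<open>ds = \<rho> d\<theta>\<close>.\<close>
definition circle_integral :: "real \<Rightarrow> (real \<Rightarrow> 'a::{banach, second_countable_topology}) \<Rightarrow> 'a" where
  "circle_integral \<rho> g = \<rho> *\<^sub>R integral\<^sup>L (lebesgue_on {0..2 * pi}) g"

definition L2_circle :: "real \<Rightarrow> (real^2 \<Rightarrow> complex^2) \<Rightarrow> bool" where
  "L2_circle \<rho> w \<longleftrightarrow>
     (\<lambda>\<theta>. w (polar_pt \<rho> \<theta>)) \<in> borel_measurable (lebesgue_on {0..2 * pi}) \<and>
     integrable (lebesgue_on {0..2 * pi}) (\<lambda>\<theta>. (norm (w (polar_pt \<rho> \<theta>)))\<^sup>2)"

definition L2_norm_circle :: "real \<Rightarrow> (real^2 \<Rightarrow> complex^2) \<Rightarrow> real" where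
  "L2_norm_circle \<rho> w = sqrt (circle_integral \<rho> (\<lambda>\<theta>. (norm (w (polar_pt \<rho> \<theta>)))\<^sup>2))"

definition dot_cnj :: "complex^2 \<Rightarrow> complex^2 \<Rightarrow> complex" where
  "dot_cnj a b = (\<Sum>i\<in>UNIV. a $ i * cnj (b $ i))"

definition f_p :: "real \<Rightarrow> (real^2 \<Rightarrow> complex^2) \<Rightarrow> int \<Rightarrow> complex" where
  "f_p \<rho> w n = of_real (1 / (2 * pi * \<rho>)) *
     circle_integral \<rho> (\<lambda>\<theta>. dot_cnj (w (polar_pt \<rho> \<theta>)) (U n \<theta>))"

definition f_s :: "real \<Rightarrow> (real^2 \<Rightarrow> complex^2) \<Rightarrow> int \<Rightarrow> complex" where
  "f_s \<rho> w n = of_real (1 / (2 * pi * \<rho>)) *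
     circle_integral \<rho> (\<lambda>\<theta>. dot_cnj (w (polar_pt \<rho> \<theta>)) (V n \<theta>))"

definition coefficient_system ::
  "real \<Rightarrow> real \<Rightarrow> real \<Rightarrow> real \<Rightarrow> (real^2 \<Rightarrow> complex^2) \<Rightarrow> (int \<Rightarrow> complex) \<Rightarrow> (int \<Rightarrow> complex) \<Rightarrow> bool" where
  "coefficient_system kp ks R \<rho> w cp cs \<longleftrightarrow> (\<forall>n.
     alpha kp R n \<rho> * cp n + \<i> * of_int n / of_real \<rho> * beta ks R n \<rho> * cs n = f_p \<rho> w n \<and>
     \<i> * of_int n / of_real \<rho> * beta kp R n \<rho> * cp n - alpha ks R n \<rho> * cs n = f_s \<rho> w n)"

end

theory Submission
  imports Defs "HOL-Complex_Analysis.Cauchy_Integral_Formula"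
begin

text \<open>
  The estimate holds because on the circle \<open>\<Gamma>\<^sub>\<rho>\<close> the truncated expansion is nothing but a partial
  Fourier sum of its own data.  At \<open>r = \<rho>\<close> the coefficients of \<open>U\<^sub>n\<close> and \<open>V\<^sub>n\<close> in the \<open>n\<close>-th
  summand are the two left-hand sides of the coefficient system, hence equal \<open>f\<^sub>p\<^sub>,\<^sub>n\<close> and
  \<open>f\<^sub>s\<^sub>,\<^sub>n\<close>: solving the system and evaluating the expansion on the same circle cancel
  (\<open>truncated_field_on_circle\<close>).  The fields \<open>U\<^sub>n\<close>, \<open>V\<^sub>n\<close> are orthogonal in \<open>L\<^sup>2(\<Gamma>\<^sub>\<rho>)\<close>, and so
  \<open>v\<^sub>N - v\<^sub>N\<^sup>\<delta>\<close> is the orthogonal projection of \<open>v - v\<^sup>\<delta>\<close>.  Bessel's inequality bounds its norm by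
  \<open>\<parallel>v - v\<^sup>\<delta>\<parallel> \<le> \<delta> \<parallel>v\<parallel>\<close> (\<open>truncated_field_stability\<close>).

  What has to be established is that the coefficients \<open>cp\<close>, \<open>cs\<close> of the Hankel expansions of the
  potentials do solve the coefficient system with the exact field \<open>v\<close> as data
  (\<open>coefficient_system_of_helmholtz\<close>).  On a circle of radius \<open>r > \<rho>\<close>, which stays away from the
  closure of the obstacle, the radial and tangential components of \<open>grad \<phi>\<^sub>p + curl \<phi>\<^sub>s\<close> are
  \<open>\<partial>\<^sub>r \<phi>\<^sub>p + \<partial>\<^sub>\<theta> \<phi>\<^sub>s / r\<close> and \<open>\<partial>\<^sub>\<theta> \<phi>\<^sub>p / r - \<partial>\<^sub>r \<phi>\<^sub>s\<close>.  Derivatives are taken of Fourier coefficients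
  rather than of the series: the series converges absolutely, hence uniformly in the angle, which
  gives the coefficients \<open>\<beta>\<^sub>n(r) c\<^sub>n\<close> of \<open>\<phi>(r, \<cdot>)\<close>; those of \<open>\<partial>\<^sub>\<theta> \<phi>\<close> follow by integration by parts, and those
  of \<open>\<partial>\<^sub>r \<phi>\<close> by differentiating the coefficient integral in \<open>r\<close>.  The last step relies on the
  Hankel functions being holomorphic near the positive axis, which is read off from their
  series.  The closure of the obstacle may touch \<open>\<Gamma>\<^sub>\<rho>\<close>, so smoothness of the potentials is only known
  outside that circle; but \<open>v\<close> is continuous up to it, and both sides of the system pass to the
  limit \<open>r \<rightarrow> \<rho>\<close> from outside.
\<close>

section \<open>Hankel functions near the positive real axis\<close>

lemma summable_fact_bound:
  fixes c :: "nat \<Rightarrow> complex"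
  assumes "\<And>m. norm (c m) \<le> (A + B * real m) / fact m" "A \<ge> 0" "B \<ge> 0"
  shows "summable (\<lambda>m. c m * w ^ m)"
proof (rule summable_comparison_test')
  \<comment> \<open>Doubling the argument of the exponential series absorbs the linear factor, as \<open>m \<le> 2\<^sup>m\<close>.\<close>
  show "summable (\<lambda>m. (A + B) * (inverse (fact m) * (2 * norm w) ^ m))"
    by (intro summable_mult summable_exp)
  show "norm (c m * w ^ m) \<le> (A + B) * (inverse (fact m) * (2 * norm w) ^ m)" for m
  proof -
    have "real m \<le> 2 ^ m" "(1::real) \<le> 2 ^ m"
      using of_nat_less_two_power[of m, where 'a = real] by (simp_all add: less_imp_le)
    hence "A + B * real m \<le> A * 2 ^ m + B * 2 ^ m"
      using assms(2,3) by (intro add_mono mult_left_mono) (auto simp: mult_le_cancel_left1)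
    hence "(A + B * real m) / fact m \<le> (A + B) * 2 ^ m / fact m"
      by (intro divide_right_mono) (simp_all add: ring_distribs)
    hence "norm (c m) \<le> (A + B) * 2 ^ m / fact m"
      using assms(1)[of m] by linarith
    hence "norm (c m) * norm w ^ m \<le> (A + B) * 2 ^ m / fact m * norm w ^ m"
      by (rule mult_right_mono) simp
    thus ?thesis
      by (simp add: norm_mult norm_power field_simps)
  qed
qed

text \<open>The series of \<open>J\<^sub>n\<close> and the regular part of \<open>Y\<^sub>n\<close> share this form: an entire function of
  \<open>(w/2)\<^sup>2\<close> times \<open>(w/2)\<^sup>n\<close>.  The factor growing linearly in \<open>m\<close> makes room for the digamma values in
  \<open>Y\<^sub>n\<close>.\<close>

lemma holomorphic_bessel_type_series:
  fixes c :: "nat \<Rightarrow> complex"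
  assumes "\<And>m. norm (c m) \<le> (A + B * real m) / fact m" "A \<ge> 0" "B \<ge> 0"
  shows "(\<lambda>w. \<Sum>m. c m * (w / 2) ^ (2 * m + n)) holomorphic_on S"
proof -
  note summ = summable_fact_bound[OF assms]
  have hol: "(\<lambda>w. \<Sum>m. c m * w ^ m) holomorphic_on UNIV"
    unfolding holomorphic_on_open[OF open_UNIV]
    using termdiffs_strong_converges_everywhere[OF summ] by blast
  have "(\<lambda>w. (\<Sum>m. c m * ((w / 2)\<^sup>2) ^ m) * (w / 2) ^ n) holomorphic_on S"
    by (intro holomorphic_intros holomorphic_on_compose_gen[OF _ hol, unfolded o_def]) auto
  also have "(\<lambda>w. (\<Sum>m. c m * ((w / 2)\<^sup>2) ^ m) * (w / 2) ^ n)
           = (\<lambda>w. \<Sum>m. c m * (w / 2) ^ (2 * m + n))"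
    by (simp only: suminf_mult2[OF summ] power_add power_mult mult.assoc)
  finally show ?thesis .
qed

lemma harm_le_of_nat: "norm (harm n :: complex) \<le> real n"
proof (induction n)
  case (Suc n)
  have "norm (harm (Suc n) :: complex) \<le> norm (harm n :: complex) + norm (inverse (of_nat (Suc n)) :: complex)"
    unfolding harm_Suc by (rule norm_triangle_ineq)
  also have "norm (inverse (of_nat (Suc n)) :: complex) \<le> 1"
    by (simp only: norm_inverse norm_of_nat) (simp add: field_simps)
  finally show ?case using Suc by simp
qed (simp add: harm_def)

text \<open>At positive integers \<open>\<psi>(m + 1)\<close> is the harmonic number \<open>H\<^sub>m\<close> minus Euler's constant, and \<open>H\<^sub>m\<close>
  is a sum of \<open>m\<close> terms of size at most \<open>1\<close>.\<close>

lemma norm_Digamma_of_nat_le: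
  "norm (Digamma (of_nat (m + 1)) :: complex) \<le> real m + norm (euler_mascheroni :: complex)"
proof -
  have "norm (Digamma (of_nat (m + 1)) :: complex)
          \<le> norm (harm m :: complex) + norm (euler_mascheroni :: complex)"
    using norm_triangle_ineq4[of "harm m :: complex" euler_mascheroni]
    by (simp only: Digamma_of_nat flip: Suc_eq_plus1)
  thus ?thesis using harm_le_of_nat[of m] by linarith
qed

lemma holomorphic_bessel_J: "bessel_J n holomorphic_on S"
proof -
  define c :: "nat \<Rightarrow> complex" where "c = (\<lambda>m. (- 1) ^ m / (fact m * fact (m + n)))"
  have cb: "norm (c m) \<le> (1 + 0 * real m) / fact m" for m
    using fact_ge_1[of "m + n", where 'a = real]
    by (simp add: c_def norm_divide norm_mult norm_power field_simps)
  have "bessel_J n = (\<lambda>w. \<Sum>m. c m * (w / 2) ^ (2 * m + n))"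
    by (simp add: fun_eq_iff bessel_J_def c_def)
  thus ?thesis
    using holomorphic_bessel_type_series[OF cb, of n S] by simp
qed

lemma holomorphic_bessel_Y: "bessel_Y n holomorphic_on - \<real>\<^sub>\<le>\<^sub>0"
proof -
  define g where "g = norm (euler_mascheroni :: complex)"
  define c :: "nat \<Rightarrow> complex" where
    "c = (\<lambda>k. (Digamma (of_nat (k + 1)) + Digamma (of_nat (n + k + 1)))
                * (- 1) ^ k / (fact k * fact (n + k)))"
  have cb: "norm (c k) \<le> ((real n + 2 * g) + 2 * real k) / fact k" for k
  proof -
    have "norm (Digamma (of_nat (k + 1)) + Digamma (of_nat (n + k + 1)) :: complex)
            \<le> (real n + 2 * g) + 2 * real k"
      using norm_triangle_ineq[of "Digamma (of_nat (k + 1)) :: complex" "Digamma (of_nat (n + k + 1))"]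
        norm_Digamma_of_nat_le[of k] norm_Digamma_of_nat_le[of "n + k"]
      unfolding g_def of_nat_add by linarith
    hence "norm (Digamma (of_nat (k + 1)) + Digamma (of_nat (n + k + 1)) :: complex) / fact k / fact (n + k)
            \<le> ((real n + 2 * g) + 2 * real k) / fact k / 1"
      using fact_ge_1[of "n + k", where 'a = real]
      by (intro frac_le divide_right_mono) (auto simp: g_def)
    thus ?thesis
      by (simp add: c_def norm_divide norm_mult norm_power)
  qed
  have series: "(\<lambda>w. \<Sum>k. c k * (w / 2) ^ (2 * k + n)) holomorphic_on - \<real>\<^sub>\<le>\<^sub>0"
    by (rule holomorphic_bessel_type_series[OF cb]) (auto simp: g_def)
  have half: "w / 2 \<notin> \<real>\<^sub>\<le>\<^sub>0" if "w \<notin> \<real>\<^sub>\<le>\<^sub>0" for w :: complex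
    using that by (auto simp: complex_nonpos_Reals_iff)
  have log: "(\<lambda>w. Ln (w / 2)) holomorphic_on - \<real>\<^sub>\<le>\<^sub>0"
    by (intro holomorphic_on_Ln' holomorphic_on_divide holomorphic_on_ident holomorphic_on_const
        half) auto
  have nz: "(w / 2) ^ n \<noteq> 0" if "w \<in> - \<real>\<^sub>\<le>\<^sub>0" for w :: complex
    using that by auto
  have principal: "(\<lambda>w. \<Sum>k<n. fact (n - k - 1) / fact k * (w / 2) ^ (2 * k) / (w / 2) ^ n)
      holomorphic_on - \<real>\<^sub>\<le>\<^sub>0"
    by (intro holomorphic_on_sum holomorphic_on_divide holomorphic_on_mult holomorphic_on_power
        holomorphic_on_ident holomorphic_on_const nz) auto
  show ?thesis
    unfolding bessel_Y_def[abs_def] c_def[symmetric]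
    by (intro holomorphic_on_diff holomorphic_on_mult holomorphic_on_const holomorphic_bessel_J
        log principal series[unfolded c_def])
qed

lemma holomorphic_hankel1: "hankel1 n holomorphic_on - \<real>\<^sub>\<le>\<^sub>0"
  unfolding hankel1_def[abs_def]
  by (intro holomorphic_on_mult holomorphic_on_add holomorphic_on_const
      holomorphic_bessel_J holomorphic_bessel_Y)

lemma hankel1_has_derivative_of_real:
  assumes "r > 0" "k > 0"
  shows "((\<lambda>r. hankel1 n (of_real (k * r))) has_vector_derivative
            of_real k * deriv (hankel1 n) (of_real (k * r))) (at r)"
proof -
  have "complex_of_real (k * r) \<in> - \<real>\<^sub>\<le>\<^sub>0"
    using assms by (simp add: complex_nonpos_Reals_iff not_le)
  hence outer: "(hankel1 n has_field_derivative deriv (hankel1 n) (of_real (k * r))) (at (of_real (k * r)))"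
    by (intro holomorphic_derivI[OF holomorphic_hankel1]) auto
  have "((\<lambda>r. k * r) has_real_derivative k) (at r)"
    by (auto intro!: derivative_eq_intros)
  hence inner: "((\<lambda>r. complex_of_real (k * r)) has_vector_derivative of_real k) (at r)"
    by (rule has_vector_derivative_of_real)
  show ?thesis
    using field_vector_diff_chain_at[OF inner outer] unfolding o_def .
qed

lemma continuous_on_hankel1_of_real:
  assumes "k > 0" "S \<subseteq> {0<..}"
  shows "continuous_on S (\<lambda>r. hankel1 n (of_real (k * r)))"
  using assms hankel1_has_derivative_of_real[OF _ assms(1)]
  by (intro continuous_at_imp_continuous_on ballI has_vector_derivative_continuous) blast

lemma continuous_on_deriv_hankel1_of_real:
  assumes "k > 0" "S \<subseteq> {0<..}"
  shows "continuous_on S (\<lambda>r. deriv (hankel1 n) (of_real (k * r)))"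
proof -
  have "continuous_on (- \<real>\<^sub>\<le>\<^sub>0) (deriv (hankel1 n))"
    by (intro holomorphic_on_imp_continuous_on holomorphic_deriv holomorphic_hankel1) auto
  moreover have "continuous_on S (\<lambda>r. complex_of_real (k * r))"
    by (intro continuous_intros)
  moreover have "(\<lambda>r. complex_of_real (k * r)) ` S \<subseteq> - \<real>\<^sub>\<le>\<^sub>0"
    using assms by (auto simp: complex_nonpos_Reals_iff not_le subset_iff simp del: of_real_mult)
  ultimately show ?thesis
    by (rule continuous_on_compose2)
qed

lemma continuous_on_alpha_beta:
  assumes "k > 0" "S \<subseteq> {0<..}"
  shows "continuous_on S (alpha k R n)" "continuous_on S (beta k R n)"
  unfolding alpha_def[abs_def] beta_def[abs_def] divide_inverse
  by (intro continuous_intros continuous_on_hankel1_of_real continuous_on_deriv_hankel1_of_real assms)+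

section \<open>Fourier coefficients and Bessel's inequality\<close>

abbreviation period_measure :: "real measure" where
  "period_measure \<equiv> lebesgue_on {0..2 * pi}"

definition fourier_coeff :: "(real \<Rightarrow> complex) \<Rightarrow> int \<Rightarrow> complex" where
  "fourier_coeff g n =
     integral\<^sup>L period_measure (\<lambda>\<theta>. g \<theta> * cis (- (of_int n * \<theta>))) / of_real (2 * pi)"

lemma fourier_coeff_continuous:
  assumes "continuous_on {0..2 * pi} g"
  shows "fourier_coeff g n = integral {0..2 * pi} (\<lambda>\<theta>. g \<theta> * cis (- (of_int n * \<theta>))) / of_real (2 * pi)"
  unfolding fourier_coeff_def
  by (subst lebesgue_integral_eq_integral)
    (auto intro!: continuous_imp_integrable_real continuous_intros assms)

lemma integrable_mult_cis:
  assumes "integrable period_measure g"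
  shows "integrable period_measure (\<lambda>\<theta>. g \<theta> * cis (c * \<theta>))"
proof (rule Bochner_Integration.integrable_bound[OF assms])
  have "(\<lambda>\<theta>. cis (c * \<theta>)) \<in> borel_measurable period_measure"
    by (intro borel_measurable_integrable continuous_imp_integrable_real continuous_intros)
  thus "(\<lambda>\<theta>. g \<theta> * cis (c * \<theta>)) \<in> borel_measurable period_measure"
    by (rule borel_measurable_times[OF borel_measurable_integrable[OF assms]])
qed (simp add: norm_mult)

lemma fourier_coeff_add:
  assumes "integrable period_measure g" "integrable period_measure h"
  shows "fourier_coeff (\<lambda>\<theta>. g \<theta> + h \<theta>) n = fourier_coeff g n + fourier_coeff h n"
proof -
  note int = integrable_mult_cis[OF assms(1), of "- of_int n"] integrable_mult_cis[OF assms(2), of "- of_int n"]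
  show ?thesis
    using Bochner_Integration.integral_add[OF int]
    by (simp add: fourier_coeff_def distrib_right add_divide_distrib)
qed

lemma fourier_coeff_diff:
  assumes "integrable period_measure g" "integrable period_measure h"
  shows "fourier_coeff (\<lambda>\<theta>. g \<theta> - h \<theta>) n = fourier_coeff g n - fourier_coeff h n"
proof -
  note int = integrable_mult_cis[OF assms(1), of "- of_int n"] integrable_mult_cis[OF assms(2), of "- of_int n"]
  show ?thesis
    using Bochner_Integration.integral_diff[OF int]
    by (simp add: fourier_coeff_def left_diff_distrib diff_divide_distrib)
qed

lemma fourier_coeff_divide: "fourier_coeff (\<lambda>\<theta>. g \<theta> / c) n = fourier_coeff g n / c"
proof -
  have "(\<lambda>\<theta>. g \<theta> / c * cis (- (of_int n * \<theta>))) = (\<lambda>\<theta>. g \<theta> * cis (- (of_int n * \<theta>)) / c)"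
    by simp
  thus ?thesis
    by (simp only: fourier_coeff_def integral_divide_zero) simp
qed

lemma cis_has_vector_derivative:
  "((\<lambda>\<theta>. cis (d * \<theta>)) has_vector_derivative \<i> * of_real d * cis (d * \<theta>)) (at \<theta>)"
proof -
  have "((\<lambda>\<theta>. d * \<theta>) has_derivative (\<lambda>t. d * t)) (at \<theta>)"
    by (intro has_derivative_mult_right has_derivative_ident)
  from has_derivative_cis[OF this] show ?thesis
    by (simp add: has_vector_derivative_def scaleR_conv_of_real mult_ac)
qed

lemma has_integral_cis_orthogonal:
  "((\<lambda>\<theta>. cis (of_int m * \<theta>) * cis (- (of_int n * \<theta>))) has_integral
      (if m = n then of_real (2 * pi) else 0)) {0..2 * pi}"
proof (cases "m = n")
  case True
  thus ?thesis
    using has_integral_const_real[of "1 :: complex" 0 "2 * pi"] by (simp add: cis_mult scaleR_conv_of_real)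
next
  case False
  define d where "d = real_of_int (m - n)"
  have d: "d \<noteq> 0" using False by (simp add: d_def)
  have "((\<lambda>\<theta>. \<i> * of_real d * cis (d * \<theta>)) has_integral
          cis (d * (2 * pi)) - cis (d * 0)) {0..2 * pi}"
    by (rule fundamental_theorem_of_calculus[OF _ has_vector_derivative_at_within[OF cis_has_vector_derivative]])
      simp
  moreover have "cis (d * (2 * pi)) = 1"
    unfolding d_def using cis_multiple_2pi[of "real_of_int (m - n)"] by (simp add: mult_ac)
  ultimately have "((\<lambda>\<theta>. \<i> * of_real d * cis (d * \<theta>)) has_integral 0) {0..2 * pi}"
    by simp
  hence "((\<lambda>\<theta>. 1 / (\<i> * of_real d) * (\<i> * of_real d * cis (d * \<theta>))) has_integral
           1 / (\<i> * of_real d) * 0) {0..2 * pi}"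
    by (rule has_integral_mult_right)
  thus ?thesis
    using False d by (simp add: cis_mult d_def left_diff_distrib)
qed

text \<open>Convergence at the single angle \<open>\<theta> = 0\<close> makes \<open>b\<close> absolutely summable, since unconditional and
  absolute summability agree for complex numbers; the Weierstrass test then gives uniform
  convergence in \<open>\<theta>\<close>, and the integral may be taken term by term.\<close>

lemma fourier_coefficient_of_has_sum:
  fixes F :: "real \<Rightarrow> complex" and b :: "int \<Rightarrow> complex"
  assumes sum: "\<And>\<theta>. ((\<lambda>n. b n * cis (of_int n * \<theta>)) has_sum F \<theta>) UNIV"
  shows "integral {0..2 * pi} (\<lambda>\<theta>. F \<theta> * cis (- (of_int n * \<theta>))) = of_real (2 * pi) * b n"
proof -
  have "b summable_on UNIV"
    using sum[of 0] by (auto simp: summable_on_def)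
  hence abs: "(\<lambda>n. norm (b n)) summable_on UNIV"
    by (simp add: summable_on_iff_abs_summable_on_complex)
  have "((\<lambda>m. b m * cis (of_int m * \<theta>) * cis (- (of_int n * \<theta>))) has_sum
           F \<theta> * cis (- (of_int n * \<theta>))) UNIV" for \<theta>
    by (intro has_sum_cmult_left sum)
  hence "uniform_limit (cbox 0 (2 * pi))
          (\<lambda>X \<theta>. \<Sum>m\<in>X. b m * cis (of_int m * \<theta>) * cis (- (of_int n * \<theta>)))
          (\<lambda>\<theta>. F \<theta> * cis (- (of_int n * \<theta>))) (finite_subsets_at_top UNIV)"
    by (intro Weierstrass_m_test_general'[OF _ _ abs]) (auto simp: norm_mult)
  then obtain I J where I: "\<And>X. ((\<lambda>\<theta>. \<Sum>m\<in>X. b m * cis (of_int m * \<theta>) * cis (- (of_int n * \<theta>)))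
        has_integral I X) (cbox 0 (2 * pi))"
    and J: "((\<lambda>\<theta>. F \<theta> * cis (- (of_int n * \<theta>))) has_integral J) (cbox 0 (2 * pi))"
    and lim: "(I \<longlongrightarrow> J) (finite_subsets_at_top UNIV)"
    by (rule uniform_limit_integral_cbox) (auto intro!: continuous_intros)
  have "I X = of_real (2 * pi) * b n" if X: "finite X" "n \<in> X" for X
  proof -
    have "((\<lambda>\<theta>. \<Sum>m\<in>X. b m * (cis (of_int m * \<theta>) * cis (- (of_int n * \<theta>)))) has_integral
             (\<Sum>m\<in>X. b m * (if m = n then of_real (2 * pi) else 0))) {0..2 * pi}"
      by (intro has_integral_sum has_integral_mult_right has_integral_cis_orthogonal X)
    also have "(\<Sum>m\<in>X. b m * (if m = n then of_real (2 * pi) else 0)) = of_real (2 * pi) * b n"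
      using X by (simp add: if_distrib[of "\<lambda>x. _ * x"] cong: if_cong)
    finally show ?thesis
      using I[of X] by (auto simp: mult.assoc intro: has_integral_unique)
  qed
  hence "eventually (\<lambda>X. I X = of_real (2 * pi) * b n) (finite_subsets_at_top UNIV)"
    unfolding eventually_finite_subsets_at_top by (intro exI[of _ "{n}"]) auto
  hence "(I \<longlongrightarrow> of_real (2 * pi) * b n) (finite_subsets_at_top UNIV)"
    by (rule tendsto_eventually)
  hence "J = of_real (2 * pi) * b n"
    using lim by (intro tendsto_unique[OF _ lim]) auto
  thus ?thesis
    using J by (simp add: integral_unique)
qed

lemma square_integrable_imp_integrable_period:
  fixes g :: "real \<Rightarrow> 'a::{banach, second_countable_topology}"
  assumes "g \<in> borel_measurable period_measure" "integrable period_measure (\<lambda>\<theta>. (norm (g \<theta>))\<^sup>2)"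
  shows "integrable period_measure g"
proof (rule Bochner_Integration.integrable_bound)
  show "integrable period_measure (\<lambda>\<theta>. 1 + (norm (g \<theta>))\<^sup>2)"
    by (intro Bochner_Integration.integrable_add assms(2) continuous_imp_integrable_real continuous_intros)
  have "norm (g \<theta>) \<le> 1 + (norm (g \<theta>))\<^sup>2" for \<theta>
    using sum_power2_ge_zero[of "norm (g \<theta>) - 1" 0] by (simp add: power2_diff)
      (smt (verit, best) norm_ge_zero zero_le_power2)
  thus "AE \<theta> in period_measure. norm (g \<theta>) \<le> norm (1 + (norm (g \<theta>))\<^sup>2)"
    by auto
qed (fact assms)

text \<open>With \<open>S\<close> the partial Fourier sum and \<open>h = g - S\<close>, the remainder \<open>h\<close> is orthogonal to every
  mode occurring in \<open>S\<close>, so the cross term in \<open>\<bar>S + h\<bar>\<^sup>2\<close> integrates to zero and dropping \<open>\<bar>h\<bar>\<^sup>2\<close> leaves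
  the inequality.\<close>

lemma bessel_inequality_period:
  assumes meas: "g \<in> borel_measurable period_measure"
    and sq: "integrable period_measure (\<lambda>\<theta>. (norm (g \<theta>))\<^sup>2)" and fin: "finite I"
  shows "integral\<^sup>L period_measure (\<lambda>\<theta>. (norm (\<Sum>n\<in>I. fourier_coeff g n * cis (of_int n * \<theta>)))\<^sup>2)
           \<le> integral\<^sup>L period_measure (\<lambda>\<theta>. (norm (g \<theta>))\<^sup>2)"
proof -
  define S where "S = (\<lambda>\<theta>. \<Sum>n\<in>I. fourier_coeff g n * cis (of_int n * \<theta>))"
  define h where "h = (\<lambda>\<theta>. g \<theta> - S \<theta>)"
  have contS: "continuous_on {0..2 * pi} S"
    unfolding S_def by (intro continuous_intros)
  have intg: "integrable period_measure g"
    by (rule square_integrable_imp_integrable_period[OF meas sq])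
  have intS: "integrable period_measure S"
    by (rule continuous_imp_integrable_real[OF contS])
  have inth: "integrable period_measure h"
    unfolding h_def by (intro Bochner_Integration.integrable_diff intg intS)
  have coeffS: "fourier_coeff S n = fourier_coeff g n" if "n \<in> I" for n
  proof -
    have "((\<lambda>\<theta>. \<Sum>m\<in>I. fourier_coeff g m * (cis (of_int m * \<theta>) * cis (- (of_int n * \<theta>)))) has_integral
             (\<Sum>m\<in>I. fourier_coeff g m * (if m = n then of_real (2 * pi) else 0))) {0..2 * pi}"
      by (intro has_integral_sum has_integral_mult_right has_integral_cis_orthogonal fin)
    also have "(\<Sum>m\<in>I. fourier_coeff g m * (if m = n then of_real (2 * pi) else 0)) = fourier_coeff g n * of_real (2 * pi)"
      using that fin by (simp add: if_distrib[of "\<lambda>x. _ * x"] cong: if_cong)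
    also have "(\<lambda>\<theta>. \<Sum>m\<in>I. fourier_coeff g m * (cis (of_int m * \<theta>) * cis (- (of_int n * \<theta>))))
                 = (\<lambda>\<theta>. S \<theta> * cis (- (of_int n * \<theta>)))"
      by (simp add: S_def sum_distrib_right mult.assoc)
    finally show ?thesis
      by (simp add: fourier_coeff_continuous[OF contS] integral_unique)
  qed
  have orth: "integral\<^sup>L period_measure (\<lambda>\<theta>. h \<theta> * cis (- (of_int n * \<theta>))) = 0" if "n \<in> I" for n
    using fourier_coeff_diff[OF intg intS, of n] coeffS[OF that]
    by (simp add: fourier_coeff_def h_def)
  have cnjS: "h \<theta> * cnj (S \<theta>) = (\<Sum>n\<in>I. h \<theta> * cis (- (of_int n * \<theta>)) * cnj (fourier_coeff g n))" for \<theta>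
    by (simp add: S_def sum_distrib_left cis_cnj mult_ac)
  have int_term: "integrable period_measure (\<lambda>\<theta>. h \<theta> * cis (- (of_int n * \<theta>)) * cnj (fourier_coeff g n))" for n
    using integrable_mult_cis[OF inth, of "- of_int n"] by (intro integrable_mult_left) simp
  have int_cross: "integrable period_measure (\<lambda>\<theta>. h \<theta> * cnj (S \<theta>))"
    unfolding cnjS by (intro Bochner_Integration.integrable_sum int_term)
  have cross: "integral\<^sup>L period_measure (\<lambda>\<theta>. h \<theta> * cnj (S \<theta>)) = 0"
  proof -
    have "integral\<^sup>L period_measure (\<lambda>\<theta>. h \<theta> * cnj (S \<theta>))
        = (\<Sum>n\<in>I. integral\<^sup>L period_measure (\<lambda>\<theta>. h \<theta> * cis (- (of_int n * \<theta>)) * cnj (fourier_coeff g n)))"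
      unfolding cnjS by (intro Bochner_Integration.integral_sum int_term)
    also have "\<dots> = 0"
      using integrable_mult_cis[OF inth, of "- of_int _"]
      by (intro sum.neutral ballI) (simp add: orth)
    finally show ?thesis .
  qed
  have int_S2: "integrable period_measure (\<lambda>\<theta>. (norm (S \<theta>))\<^sup>2)"
    by (intro continuous_imp_integrable_real continuous_intros contS)
  have "(norm (S \<theta>))\<^sup>2 + 2 * Re (h \<theta> * cnj (S \<theta>)) \<le> (norm (g \<theta>))\<^sup>2" for \<theta>
  proof -
    have "(norm (S \<theta> + h \<theta>))\<^sup>2 = (norm (S \<theta>))\<^sup>2 + 2 * Re (h \<theta> * cnj (S \<theta>)) + (norm (h \<theta>))\<^sup>2"
      unfolding cmod_power2 by (simp add: power2_eq_square algebra_simps)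
    thus ?thesis by (simp add: h_def)
  qed
  hence "integral\<^sup>L period_measure (\<lambda>\<theta>. (norm (S \<theta>))\<^sup>2 + 2 * Re (h \<theta> * cnj (S \<theta>)))
          \<le> integral\<^sup>L period_measure (\<lambda>\<theta>. (norm (g \<theta>))\<^sup>2)"
    by (intro integral_mono Bochner_Integration.integrable_add integrable_mult_right integrable_Re
        int_S2 int_cross sq)
  also have "integral\<^sup>L period_measure (\<lambda>\<theta>. (norm (S \<theta>))\<^sup>2 + 2 * Re (h \<theta> * cnj (S \<theta>)))
      = integral\<^sup>L period_measure (\<lambda>\<theta>. (norm (S \<theta>))\<^sup>2) + 2 * Re (integral\<^sup>L period_measure (\<lambda>\<theta>. h \<theta> * cnj (S \<theta>)))"
    by (subst Bochner_Integration.integral_add)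
      (simp_all only: int_S2 integral_Re[OF int_cross] integral_mult_right_zero
        integrable_mult_right[OF integrable_Re[OF int_cross]])
  finally show ?thesis
    unfolding cross by (simp add: S_def)
qed

section \<open>Polar frame\<close>

lemma exp_i_eq_cis: "exp (\<i> * of_int n * of_real \<theta>) = cis (of_int n * \<theta>)"
  by (simp add: cis_conv_exp mult_ac)

lemma norm_complex_pair: "(norm (a :: complex^2))\<^sup>2 = (norm (a $ 1))\<^sup>2 + (norm (a $ 2))\<^sup>2"
  by (simp add: norm_vec_def L2_set_def sum_2)

lemma dot_cnj_e_r: "dot_cnj a (e_r \<theta>) = a $ 1 * of_real (cos \<theta>) + a $ 2 * of_real (sin \<theta>)"
  by (simp add: dot_cnj_def e_r_def sum_2)

lemma dot_cnj_e_theta: "dot_cnj a (e_theta \<theta>) = - a $ 1 * of_real (sin \<theta>) + a $ 2 * of_real (cos \<theta>)"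
  by (simp add: dot_cnj_def e_theta_def sum_2)

lemma dot_cnj_U: "dot_cnj a (U n \<theta>) = dot_cnj a (e_r \<theta>) * cis (- (of_int n * \<theta>))"
  unfolding dot_cnj_def U_def exp_i_eq_cis by (simp add: cis_cnj sum_2 algebra_simps)

lemma dot_cnj_V: "dot_cnj a (V n \<theta>) = dot_cnj a (e_theta \<theta>) * cis (- (of_int n * \<theta>))"
  unfolding dot_cnj_def V_def exp_i_eq_cis by (simp add: cis_cnj sum_2 algebra_simps)

lemma rotation_norm:
  fixes a b :: complex
  shows "(norm (a * of_real (cos \<theta>) - b * of_real (sin \<theta>)))\<^sup>2
       + (norm (a * of_real (sin \<theta>) + b * of_real (cos \<theta>)))\<^sup>2 = (norm a)\<^sup>2 + (norm b)\<^sup>2"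
proof -
  have "(norm (a * of_real c - b * of_real s))\<^sup>2 + (norm (a * of_real s + b * of_real c))\<^sup>2
     = ((norm a)\<^sup>2 + (norm b)\<^sup>2) * (c\<^sup>2 + s\<^sup>2)" for c s :: real
    unfolding cmod_power2 by (simp add: power2_eq_square algebra_simps)
  thus ?thesis by simp
qed

lemma norm_polar_combination: "(norm (a *s e_r \<theta> + b *s e_theta \<theta>))\<^sup>2 = (norm a)\<^sup>2 + (norm b)\<^sup>2"
  using rotation_norm[of a \<theta> b] by (simp add: norm_complex_pair e_r_def e_theta_def)

lemma norm_polar_components: "(norm a)\<^sup>2 = (norm (dot_cnj a (e_r \<theta>)))\<^sup>2 + (norm (dot_cnj a (e_theta \<theta>)))\<^sup>2"
  using rotation_norm[of "a $ 2" \<theta> "a $ 1"]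
  by (simp add: norm_complex_pair dot_cnj_e_r dot_cnj_e_theta algebra_simps)

lemma dot_cnj_polar_combination:
  "dot_cnj (a *s e_r \<theta> + b *s e_theta \<theta>) (e_r \<theta>) = a"
  "dot_cnj (a *s e_r \<theta> + b *s e_theta \<theta>) (e_theta \<theta>) = b"
proof -
  have cs: "complex_of_real (cos \<theta>) * of_real (cos \<theta>) = 1 - of_real (sin \<theta>) * of_real (sin \<theta>)"
    using sin_cos_squared_add3[of \<theta>] by (metis add_diff_cancel_right' of_real_1 of_real_add of_real_mult)
  show "dot_cnj (a *s e_r \<theta> + b *s e_theta \<theta>) (e_r \<theta>) = a"
    unfolding dot_cnj_e_r by (simp add: e_r_def e_theta_def algebra_simps cs del: of_real_mult)
  show "dot_cnj (a *s e_r \<theta> + b *s e_theta \<theta>) (e_theta \<theta>) = b"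
    unfolding dot_cnj_e_theta by (simp add: e_r_def e_theta_def algebra_simps cs del: of_real_mult)
qed

lemma norm_polar_pt: "r \<ge> 0 \<Longrightarrow> norm (polar_pt r \<theta>) = r"
  by (simp add: polar_pt_def norm_vec_def L2_set_def sum_2 power_mult_distrib
      flip: distrib_left)

text \<open>The angle recovered from a point is the principal argument, which agrees with \<open>\<theta>\<close> only modulo
  \<open>2\<pi>\<close>.  Everything built from the angle is periodic, and is transferred through this identity.\<close>

lemma cis_polar_angle:
  assumes "r > 0"
  shows "cis (polar_angle (polar_pt r \<theta>)) = cis \<theta>"
proof -
  have "Complex (polar_pt r \<theta> $ 1) (polar_pt r \<theta> $ 2) = rcis r \<theta>"
    by (simp add: polar_pt_def complex_eq_iff)
  thus ?thesis
    using assms by (simp add: polar_angle_def cis_Arg rcis_def sgn_mult)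
qed

lemma cis_int_mult_polar_angle:
  assumes "r > 0"
  shows "cis (of_int n * polar_angle (polar_pt r \<theta>)) = cis (of_int n * \<theta>)"
  by (metis cis_polar_angle[OF assms] cis_power_int)

lemma cos_sin_polar_angle:
  assumes "r > 0"
  shows "cos (polar_angle (polar_pt r \<theta>)) = cos \<theta>" "sin (polar_angle (polar_pt r \<theta>)) = sin \<theta>"
  using cis_polar_angle[OF assms, of \<theta>] by (simp_all add: complex_eq_iff)

lemma e_polar_angle:
  assumes "r > 0"
  shows "e_r (polar_angle (polar_pt r \<theta>)) = e_r \<theta>" "e_theta (polar_angle (polar_pt r \<theta>)) = e_theta \<theta>"
  by (simp_all add: e_r_def e_theta_def cos_sin_polar_angle[OF assms])

lemma polar_pt_polar_angle:
  assumes "r > 0"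
  shows "polar_pt r (polar_angle (polar_pt r \<theta>)) = polar_pt r \<theta>"
  unfolding polar_pt_def[of r "polar_angle _"] cos_sin_polar_angle[OF assms]
  by (simp add: polar_pt_def)

lemma continuous_on_vector_2:
  assumes "continuous_on S f" "continuous_on S g"
  shows "continuous_on S (\<lambda>x. vector [f x, g x] :: 'a :: real_normed_vector ^ 2)"
proof -
  have eq: "(\<lambda>x. vector [f x, g x] :: 'a ^ 2) = (\<lambda>x. \<chi> i. if i = 1 then f x else g x)"
    by (auto simp: fun_eq_iff vec_eq_iff forall_2)
  have "continuous_on S (\<lambda>x. if i = 1 then f x else g x)" for i :: 2
    using assms by (cases "i = 1") auto
  thus ?thesis
    unfolding eq by (rule continuous_on_vec_lambda)
qed

lemma continuous_on_e_r: "continuous_on S e_r"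
  unfolding e_r_def by (intro continuous_on_vector_2 continuous_intros)

lemma continuous_on_e_theta: "continuous_on S e_theta"
  unfolding e_theta_def by (intro continuous_on_vector_2 continuous_intros)

lemma continuous_on_polar_pt:
  fixes f g :: "'a :: t2_space \<Rightarrow> real"
  assumes "continuous_on S f" "continuous_on S g"
  shows "continuous_on S (\<lambda>x. polar_pt (f x) (g x))"
  unfolding polar_pt_def by (intro continuous_on_vector_2 continuous_on_mult continuous_on_cos continuous_on_sin assms)

section \<open>The truncated expansion on the measurement circle\<close>

lemma f_p_eq_fourier_coeff:
  assumes "\<rho> > 0"
  shows "f_p \<rho> w n = fourier_coeff (\<lambda>\<theta>. dot_cnj (w (polar_pt \<rho> \<theta>)) (e_r \<theta>)) n"
  using assms by (simp add: f_p_def circle_integral_def fourier_coeff_def dot_cnj_U scaleR_conv_of_real)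

lemma f_s_eq_fourier_coeff:
  assumes "\<rho> > 0"
  shows "f_s \<rho> w n = fourier_coeff (\<lambda>\<theta>. dot_cnj (w (polar_pt \<rho> \<theta>)) (e_theta \<theta>)) n"
  using assms by (simp add: f_s_def circle_integral_def fourier_coeff_def dot_cnj_V scaleR_conv_of_real)

text \<open>At \<open>r = \<rho>\<close> the brackets multiplying \<open>U\<^sub>n\<close> and \<open>V\<^sub>n\<close> are the left-hand sides of the coefficient
  system, and are replaced by its right-hand sides.  The expansion is therefore a partial Fourier
  sum of \<open>w\<close>, written in the frame \<open>(e\<^sub>r, e\<^sub>\<theta>)\<close>.\<close>

lemma truncated_field_on_circle:
  assumes "\<rho> > 0" "coefficient_system kp ks R \<rho> w cp cs"
  shows "truncated_field kp ks R cp cs N (polar_pt \<rho> \<theta>) =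
           (\<Sum>n = - int N..int N. f_p \<rho> w n * cis (of_int n * \<theta>)) *s e_r \<theta>
         + (\<Sum>n = - int N..int N. f_s \<rho> w n * cis (of_int n * \<theta>)) *s e_theta \<theta>"
proof -
  have "truncated_field kp ks R cp cs N (polar_pt \<rho> \<theta>)
      = (\<Sum>n = - int N..int N. f_p \<rho> w n *s U n \<theta> + f_s \<rho> w n *s V n \<theta>)"
    using assms
    by (simp add: truncated_field_def Let_def coefficient_system_def norm_polar_pt
        U_def V_def exp_i_eq_cis cis_int_mult_polar_angle e_polar_angle)
  thus ?thesis
    unfolding U_def V_def exp_i_eq_cis
    by (simp add: sum.distrib vec_eq_iff sum_distrib_right mult.assoc)
qed

lemma borel_measurable_dot_cnj:
  assumes "w \<in> borel_measurable period_measure" "continuous_on {0..2 * pi} e"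
  shows "(\<lambda>\<theta>. dot_cnj (w \<theta>) (e \<theta>)) \<in> borel_measurable period_measure"
proof -
  have w: "(\<lambda>\<theta>. w \<theta> $ i) \<in> borel_measurable period_measure" for i
    by (intro measurable_compose[OF assms(1)] borel_measurable_continuous_onI continuous_intros)
  have e: "(\<lambda>\<theta>. cnj (e \<theta> $ i)) \<in> borel_measurable period_measure" for i
    by (intro borel_measurable_integrable continuous_imp_integrable_real continuous_intros assms)
  show ?thesis
    unfolding dot_cnj_def by (intro borel_measurable_sum borel_measurable_times w e)
qed

lemma L2_circle_components:
  assumes "L2_circle \<rho> w" "e = e_r \<or> e = e_theta"
  shows "(\<lambda>\<theta>. dot_cnj (w (polar_pt \<rho> \<theta>)) (e \<theta>)) \<in> borel_measurable period_measure"
    and "integrable period_measure (\<lambda>\<theta>. (norm (dot_cnj (w (polar_pt \<rho> \<theta>)) (e \<theta>)))\<^sup>2)"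
proof -
  show meas: "(\<lambda>\<theta>. dot_cnj (w (polar_pt \<rho> \<theta>)) (e \<theta>)) \<in> borel_measurable period_measure"
    using assms by (intro borel_measurable_dot_cnj) (auto simp: L2_circle_def continuous_on_e_r continuous_on_e_theta)
  show "integrable period_measure (\<lambda>\<theta>. (norm (dot_cnj (w (polar_pt \<rho> \<theta>)) (e \<theta>)))\<^sup>2)"
  proof (rule Bochner_Integration.integrable_bound)
    show "integrable period_measure (\<lambda>\<theta>. (norm (w (polar_pt \<rho> \<theta>)))\<^sup>2)"
      using assms(1) by (simp add: L2_circle_def)
    have "(norm (dot_cnj (w (polar_pt \<rho> \<theta>)) (e \<theta>)))\<^sup>2 \<le> (norm (w (polar_pt \<rho> \<theta>)))\<^sup>2" for \<theta>
      using assms(2) norm_polar_components[of "w (polar_pt \<rho> \<theta>)" \<theta>] by auto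
    thus "AE \<theta> in period_measure. norm ((norm (dot_cnj (w (polar_pt \<rho> \<theta>)) (e \<theta>)))\<^sup>2)
        \<le> norm ((norm (w (polar_pt \<rho> \<theta>)))\<^sup>2)"
      by simp
  qed (rule borel_measurable_power[OF measurable_compose[OF meas borel_measurable_norm]])
qed

lemma L2_circle_diff:
  assumes "L2_circle \<rho> v" "L2_circle \<rho> w"
  shows "L2_circle \<rho> (\<lambda>x. v x - w x)"
proof -
  have meas: "(\<lambda>\<theta>. v (polar_pt \<rho> \<theta>) - w (polar_pt \<rho> \<theta>)) \<in> borel_measurable period_measure"
    using assms by (intro borel_measurable_diff) (auto simp: L2_circle_def)
  have "integrable period_measure (\<lambda>\<theta>. (norm (v (polar_pt \<rho> \<theta>) - w (polar_pt \<rho> \<theta>)))\<^sup>2)"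
  proof (rule Bochner_Integration.integrable_bound)
    show "integrable period_measure
        (\<lambda>\<theta>. 2 * (norm (v (polar_pt \<rho> \<theta>)))\<^sup>2 + 2 * (norm (w (polar_pt \<rho> \<theta>)))\<^sup>2)"
      using assms by (intro Bochner_Integration.integrable_add integrable_mult_right)
        (auto simp: L2_circle_def)
    have "(norm (a - b))\<^sup>2 \<le> 2 * (norm a)\<^sup>2 + 2 * (norm b)\<^sup>2" for a b :: "complex^2"
    proof -
      have "(norm (a - b))\<^sup>2 \<le> (norm a + norm b)\<^sup>2"
        by (intro power_mono norm_triangle_ineq4) simp
      thus ?thesis
        using zero_le_power2[of "norm a - norm b"] unfolding power2_diff power2_sum by linarith
    qed
    thus "AE \<theta> in period_measure. norm ((norm (v (polar_pt \<rho> \<theta>) - w (polar_pt \<rho> \<theta>)))\<^sup>2)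
        \<le> norm (2 * (norm (v (polar_pt \<rho> \<theta>)))\<^sup>2 + 2 * (norm (w (polar_pt \<rho> \<theta>)))\<^sup>2)"
      by simp
  qed (rule borel_measurable_power[OF measurable_compose[OF meas borel_measurable_norm]])
  thus ?thesis
    using meas by (simp add: L2_circle_def)
qed

lemma L2_circle_continuous:
  assumes "continuous_on {x. norm x \<ge> \<rho>} v" "\<rho> > 0"
  shows "L2_circle \<rho> v"
proof -
  have "continuous_on {0..2 * pi} (\<lambda>\<theta>. v (polar_pt \<rho> \<theta>))"
    using assms by (intro continuous_on_compose2[OF assms(1) continuous_on_polar_pt])
      (auto intro!: continuous_intros simp: norm_polar_pt)
  thus ?thesis
    unfolding L2_circle_def
    by (intro conjI borel_measurable_integrable continuous_imp_integrable_real continuous_intros)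
qed

lemma f_p_f_s_diff:
  assumes "\<rho> > 0" "L2_circle \<rho> v" "L2_circle \<rho> w"
  shows "f_p \<rho> (\<lambda>x. v x - w x) n = f_p \<rho> v n - f_p \<rho> w n"
    and "f_s \<rho> (\<lambda>x. v x - w x) n = f_s \<rho> v n - f_s \<rho> w n"
proof -
  have dist: "dot_cnj (a - b) c = dot_cnj a c - dot_cnj b c" for a b c
    by (simp add: dot_cnj_def left_diff_distrib sum_subtractf)
  have int: "integrable period_measure (\<lambda>\<theta>. dot_cnj (u (polar_pt \<rho> \<theta>)) (e \<theta>))"
    if "L2_circle \<rho> u" "e = e_r \<or> e = e_theta" for u e
    by (rule square_integrable_imp_integrable_period[OF L2_circle_components[OF that]])
  show "f_p \<rho> (\<lambda>x. v x - w x) n = f_p \<rho> v n - f_p \<rho> w n"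
       "f_s \<rho> (\<lambda>x. v x - w x) n = f_s \<rho> v n - f_s \<rho> w n"
    using assms by (simp_all add: f_p_eq_fourier_coeff f_s_eq_fourier_coeff dist fourier_coeff_diff int)
qed

text \<open>The rotating frame \<open>(e\<^sub>r, e\<^sub>\<theta>)\<close> is orthonormal at each angle, so the squared norm splits into the
  radial and the tangential component, and the scalar Bessel inequality applies to each.\<close>

lemma truncated_field_stability:
  assumes "\<rho> > 0" and L2: "L2_circle \<rho> v" "L2_circle \<rho> w"
    and sys: "coefficient_system kp ks R \<rho> v cp cs" "coefficient_system kp ks R \<rho> w dp ds"
  shows "L2_norm_circle \<rho> (\<lambda>x. truncated_field kp ks R cp cs N x - truncated_field kp ks R dp ds N x)
           \<le> L2_norm_circle \<rho> (\<lambda>x. v x - w x)"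
proof -
  define u where "u = (\<lambda>x. v x - w x)"
  have u: "L2_circle \<rho> u" unfolding u_def by (rule L2_circle_diff[OF L2])
  define a where "a = (\<lambda>\<theta>. dot_cnj (u (polar_pt \<rho> \<theta>)) (e_r \<theta>))"
  define b where "b = (\<lambda>\<theta>. dot_cnj (u (polar_pt \<rho> \<theta>)) (e_theta \<theta>))"
  define A where "A = (\<lambda>\<theta>. \<Sum>n = - int N..int N. fourier_coeff a n * cis (of_int n * \<theta>))"
  define B where "B = (\<lambda>\<theta>. \<Sum>n = - int N..int N. fourier_coeff b n * cis (of_int n * \<theta>))"
  have ab: "a \<in> borel_measurable period_measure" "integrable period_measure (\<lambda>\<theta>. (norm (a \<theta>))\<^sup>2)"
           "b \<in> borel_measurable period_measure" "integrable period_measure (\<lambda>\<theta>. (norm (b \<theta>))\<^sup>2)"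
    unfolding a_def b_def by (intro L2_circle_components[OF u]; simp)+
  have AB: "integrable period_measure (\<lambda>\<theta>. (norm (A \<theta>))\<^sup>2)" "integrable period_measure (\<lambda>\<theta>. (norm (B \<theta>))\<^sup>2)"
    unfolding A_def B_def by (intro continuous_imp_integrable_real continuous_intros)+
  have coeffs: "fourier_coeff a n = f_p \<rho> v n - f_p \<rho> w n" "fourier_coeff b n = f_s \<rho> v n - f_s \<rho> w n" for n
    using f_p_f_s_diff[OF \<open>\<rho> > 0\<close> L2, of n]
    by (simp_all add: a_def b_def u_def f_p_eq_fourier_coeff[OF \<open>\<rho> > 0\<close>] f_s_eq_fourier_coeff[OF \<open>\<rho> > 0\<close>])
  have "truncated_field kp ks R cp cs N (polar_pt \<rho> \<theta>) - truncated_field kp ks R dp ds N (polar_pt \<rho> \<theta>)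
          = A \<theta> *s e_r \<theta> + B \<theta> *s e_theta \<theta>" for \<theta>
    unfolding A_def B_def coeffs truncated_field_on_circle[OF \<open>\<rho> > 0\<close> sys(1)]
      truncated_field_on_circle[OF \<open>\<rho> > 0\<close> sys(2)]
    by (simp add: vec_eq_iff left_diff_distrib sum_subtractf algebra_simps)
  hence "integral\<^sup>L period_measure (\<lambda>\<theta>. (norm (truncated_field kp ks R cp cs N (polar_pt \<rho> \<theta>)
            - truncated_field kp ks R dp ds N (polar_pt \<rho> \<theta>)))\<^sup>2)
       = integral\<^sup>L period_measure (\<lambda>\<theta>. (norm (A \<theta>))\<^sup>2) + integral\<^sup>L period_measure (\<lambda>\<theta>. (norm (B \<theta>))\<^sup>2)"
    by (simp add: norm_polar_combination AB)
  also have "\<dots> \<le> integral\<^sup>L period_measure (\<lambda>\<theta>. (norm (a \<theta>))\<^sup>2) + integral\<^sup>L period_measure (\<lambda>\<theta>. (norm (b \<theta>))\<^sup>2)"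
    unfolding A_def B_def by (intro add_mono bessel_inequality_period ab) auto
  also have "\<dots> = integral\<^sup>L period_measure (\<lambda>\<theta>. (norm (a \<theta>))\<^sup>2 + (norm (b \<theta>))\<^sup>2)"
    by (simp add: ab)
  also have "\<dots> = integral\<^sup>L period_measure (\<lambda>\<theta>. (norm (u (polar_pt \<rho> \<theta>)))\<^sup>2)"
    unfolding a_def b_def by (simp flip: norm_polar_components)
  finally show ?thesis
    using \<open>\<rho> > 0\<close> by (simp add: L2_norm_circle_def circle_integral_def u_def)
qed

section \<open>Potentials in polar coordinates\<close>

lemma has_derivative_pd:
  fixes \<phi> :: "real^2 \<Rightarrow> 'a::real_normed_vector"
  assumes "\<phi> differentiable (at x)"
  shows "(\<phi> has_derivative (\<lambda>h. h $ 1 *\<^sub>R pd 1 \<phi> x + h $ 2 *\<^sub>R pd 2 \<phi> x)) (at x)"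
proof -
  have D: "(\<phi> has_derivative frechet_derivative \<phi> (at x)) (at x)"
    using assms by (simp add: frechet_derivative_works)
  interpret bounded_linear "frechet_derivative \<phi> (at x)"
    by (rule has_derivative_bounded_linear[OF D])
  have "frechet_derivative \<phi> (at x) h = h $ 1 *\<^sub>R pd 1 \<phi> x + h $ 2 *\<^sub>R pd 2 \<phi> x" for h
  proof -
    have "h = h $ 1 *\<^sub>R axis 1 1 + h $ 2 *\<^sub>R axis 2 1"
      by (simp add: vec_eq_iff forall_2 axis_def)
    hence "frechet_derivative \<phi> (at x) h
             = frechet_derivative \<phi> (at x) (h $ 1 *\<^sub>R axis 1 1 + h $ 2 *\<^sub>R axis 2 1)"
      by (rule arg_cong)
    thus ?thesis
      by (simp only: add scaleR pd_def)
  qed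
  hence "frechet_derivative \<phi> (at x) = (\<lambda>h. h $ 1 *\<^sub>R pd 1 \<phi> x + h $ 2 *\<^sub>R pd 2 \<phi> x)"
    by (rule ext)
  thus ?thesis using D by simp
qed

text \<open>The partial derivatives of \<open>\<phi>\<close> in polar coordinates, as functions of radius and angle; \<open>angular_slope\<close>
  below is \<open>\<partial>\<^sub>\<theta> \<phi>\<close>, without the factor \<open>1/r\<close>.  Their closed form in terms of the Cartesian partial
  derivatives makes joint continuity in \<open>(r, \<theta>)\<close> evident.\<close>

definition radial_slope :: "(real^2 \<Rightarrow> complex) \<Rightarrow> real \<Rightarrow> real \<Rightarrow> complex" where
  "radial_slope \<phi> r \<theta> =
     of_real (cos \<theta>) * pd 1 \<phi> (polar_pt r \<theta>) + of_real (sin \<theta>) * pd 2 \<phi> (polar_pt r \<theta>)"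

definition angular_slope :: "(real^2 \<Rightarrow> complex) \<Rightarrow> real \<Rightarrow> real \<Rightarrow> complex" where
  "angular_slope \<phi> r \<theta> =
     of_real (r * cos \<theta>) * pd 2 \<phi> (polar_pt r \<theta>) - of_real (r * sin \<theta>) * pd 1 \<phi> (polar_pt r \<theta>)"

lemma has_vector_derivative_vector_2:
  assumes "(f has_real_derivative f') (at x)" "(g has_real_derivative g') (at x)"
  shows "((\<lambda>x. vector [f x, g x] :: real^2) has_vector_derivative vector [f', g']) (at x)"
proof -
  have eq: "(vector [a, b] :: real^2) = a *\<^sub>R axis 1 1 + b *\<^sub>R axis 2 1" for a b
    by (simp add: vec_eq_iff forall_2 axis_def)
  have "((\<lambda>x. f x *\<^sub>R axis 1 1 + g x *\<^sub>R axis 2 1 :: real^2) has_vector_derivative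
          f' *\<^sub>R axis 1 1 + g' *\<^sub>R axis 2 1) (at x)"
    using assms by (auto intro!: derivative_eq_intros)
  thus ?thesis unfolding eq .
qed

lemma radial_slope_has_derivative:
  assumes "\<phi> differentiable (at (polar_pt r \<theta>))"
  shows "((\<lambda>r. \<phi> (polar_pt r \<theta>)) has_vector_derivative radial_slope \<phi> r \<theta>) (at r)"
proof -
  have "((\<lambda>r. polar_pt r \<theta>) has_vector_derivative vector [cos \<theta>, sin \<theta>]) (at r)"
    unfolding polar_pt_def
    by (rule has_vector_derivative_vector_2) (auto intro!: derivative_eq_intros)
  from vector_derivative_diff_chain_within[OF this has_derivative_at_withinI[OF has_derivative_pd[OF assms]]]
  show ?thesis
    by (simp add: o_def radial_slope_def scaleR_conv_of_real)
qed

lemma angular_slope_has_derivative: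
  assumes "\<phi> differentiable (at (polar_pt r \<theta>))"
  shows "((\<lambda>\<theta>. \<phi> (polar_pt r \<theta>)) has_vector_derivative angular_slope \<phi> r \<theta>) (at \<theta>)"
proof -
  have "((\<lambda>\<theta>. polar_pt r \<theta>) has_vector_derivative vector [- r * sin \<theta>, r * cos \<theta>]) (at \<theta>)"
    unfolding polar_pt_def
    by (rule has_vector_derivative_vector_2) (auto intro!: derivative_eq_intros)
  from vector_derivative_diff_chain_within[OF this has_derivative_at_withinI[OF has_derivative_pd[OF assms]]]
  show ?thesis
    by (simp add: o_def angular_slope_def scaleR_conv_of_real)
qed

lemma grad_polar_components:
  assumes "r > 0"
  shows "dot_cnj (grad \<phi> (polar_pt r \<theta>)) (e_r \<theta>) = radial_slope \<phi> r \<theta>"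
    and "dot_cnj (grad \<phi> (polar_pt r \<theta>)) (e_theta \<theta>) = angular_slope \<phi> r \<theta> / of_real r"
  using assms by (simp_all add: dot_cnj_e_r dot_cnj_e_theta grad_def radial_slope_def angular_slope_def field_simps)

lemma curl_pol_polar_pt:
  assumes "r > 0" "\<phi> differentiable (at (polar_pt r \<theta>))"
  shows "curl_pol \<phi> (polar_pt r \<theta>)
           = (angular_slope \<phi> r \<theta> / of_real r) *s e_r \<theta> - radial_slope \<phi> r \<theta> *s e_theta \<theta>"
proof -
  define t where "t = polar_angle (polar_pt r \<theta>)"
  have t: "polar_pt r t = polar_pt r \<theta>" "cos t = cos \<theta>" "sin t = sin \<theta>" "norm (polar_pt r \<theta>) = r"
    "e_r t = e_r \<theta>" "e_theta t = e_theta \<theta>"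
    using assms(1) unfolding t_def
    by (simp_all add: polar_pt_polar_angle cos_sin_polar_angle norm_polar_pt e_polar_angle)
  have diff: "\<phi> differentiable (at (polar_pt r t))"
    using assms(2) by (simp add: t)
  have "radial_deriv \<phi> (polar_pt r \<theta>) = radial_slope \<phi> r t"
    unfolding radial_deriv_def t_def[symmetric] t
    by (rule vector_derivative_at[OF radial_slope_has_derivative[OF diff]])
  moreover have "angular_deriv \<phi> (polar_pt r \<theta>) = angular_slope \<phi> r t"
    unfolding angular_deriv_def t_def[symmetric] t
    by (rule vector_derivative_at[OF angular_slope_has_derivative[OF diff]])
  moreover have "radial_slope \<phi> r t = radial_slope \<phi> r \<theta>" "angular_slope \<phi> r t = angular_slope \<phi> r \<theta>"
    by (simp_all add: radial_slope_def angular_slope_def t)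
  ultimately show ?thesis
    by (simp add: curl_pol_def t_def[symmetric] t)
qed

lemma helmholtz_polar_components:
  assumes "r > 0" "\<phi>s differentiable (at (polar_pt r \<theta>))"
    and "w = grad \<phi>p (polar_pt r \<theta>) + curl_pol \<phi>s (polar_pt r \<theta>)"
  shows "dot_cnj w (e_r \<theta>) = radial_slope \<phi>p r \<theta> + angular_slope \<phi>s r \<theta> / of_real r"
    and "dot_cnj w (e_theta \<theta>) = angular_slope \<phi>p r \<theta> / of_real r - radial_slope \<phi>s r \<theta>"
proof -
  have add: "dot_cnj (a + b) c = dot_cnj a c + dot_cnj b c" for a b c
    by (simp add: dot_cnj_def sum.distrib ring_distribs)
  have "curl_pol \<phi>s (polar_pt r \<theta>)
      = (angular_slope \<phi>s r \<theta> / of_real r) *s e_r \<theta> + (- radial_slope \<phi>s r \<theta>) *s e_theta \<theta>"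
    using curl_pol_polar_pt[OF assms(1,2)] by (simp add: vec_eq_iff)
  hence curl: "dot_cnj (curl_pol \<phi>s (polar_pt r \<theta>)) (e_r \<theta>) = angular_slope \<phi>s r \<theta> / of_real r"
      "dot_cnj (curl_pol \<phi>s (polar_pt r \<theta>)) (e_theta \<theta>) = - radial_slope \<phi>s r \<theta>"
    by (simp_all only: dot_cnj_polar_combination)
  show "dot_cnj w (e_r \<theta>) = radial_slope \<phi>p r \<theta> + angular_slope \<phi>s r \<theta> / of_real r"
       "dot_cnj w (e_theta \<theta>) = angular_slope \<phi>p r \<theta> / of_real r - radial_slope \<phi>s r \<theta>"
    unfolding assms(3)
    by (simp_all only: add curl grad_polar_components[OF assms(1)] diff_conv_add_uminus)
qed

lemma continuous_on_slopes:
  assumes "C2_on {x. norm x > a} \<phi>" "a \<ge> 0" "S \<subseteq> {a<..} \<times> UNIV"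
  shows "continuous_on S (\<lambda>(r, \<theta>). radial_slope \<phi> r \<theta>)"
    and "continuous_on S (\<lambda>(r, \<theta>). angular_slope \<phi> r \<theta>)"
proof -
  have pd: "continuous_on {x. norm x > a} (pd i \<phi>)" for i
    using assms(1) by (auto simp: C2_on_def intro!: continuous_at_imp_continuous_on differentiable_imp_continuous_within)
  have img: "(\<lambda>p. polar_pt (fst p) (snd p)) ` S \<subseteq> {x. norm x > a}"
    using assms(2,3) by (auto simp: norm_polar_pt subset_iff)
  have *: "continuous_on S (\<lambda>p. pd i \<phi> (polar_pt (fst p) (snd p)))" for i
    by (rule continuous_on_compose2[OF pd continuous_on_polar_pt img]) (intro continuous_intros)+
  show "continuous_on S (\<lambda>(r, \<theta>). radial_slope \<phi> r \<theta>)"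
       "continuous_on S (\<lambda>(r, \<theta>). angular_slope \<phi> r \<theta>)"
    unfolding radial_slope_def angular_slope_def case_prod_beta
    by (intro continuous_intros *)+
qed

lemma continuous_on_slopes_circle:
  assumes "C2_on {x. norm x > a} \<phi>" "a \<ge> 0" "r > a"
  shows "continuous_on S (radial_slope \<phi> r)" "continuous_on S (angular_slope \<phi> r)"
proof -
  have *: "continuous_on S (\<lambda>\<theta>. (r, \<theta>))" "(\<lambda>\<theta>. (r, \<theta>)) ` S \<subseteq> {r} \<times> UNIV"
    by (auto intro!: continuous_intros)
  have sub: "{r} \<times> UNIV \<subseteq> {a<..} \<times> (UNIV :: real set)" using assms(3) by auto
  show "continuous_on S (radial_slope \<phi> r)" "continuous_on S (angular_slope \<phi> r)"
    using continuous_on_compose2[OF continuous_on_slopes(1)[OF assms(1,2) sub] *]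
          continuous_on_compose2[OF continuous_on_slopes(2)[OF assms(1,2) sub] *] by simp_all
qed

lemma polar_pt_differentiable:
  assumes "C2_on {x. norm x > a} \<phi>" "a \<ge> 0" "r > a"
  shows "\<phi> differentiable (at (polar_pt r \<theta>))"
  using assms by (simp add: C2_on_def norm_polar_pt)

lemma continuous_on_circle_of_C2:
  fixes \<phi> :: "real^2 \<Rightarrow> complex"
  assumes "C2_on {x. norm x > a} \<phi>" "a \<ge> 0" "r > a"
  shows "continuous_on S (\<lambda>\<theta>. \<phi> (polar_pt r \<theta>))"
  by (intro continuous_at_imp_continuous_on ballI
      has_vector_derivative_continuous[OF angular_slope_has_derivative[OF polar_pt_differentiable[OF assms]]])

section \<open>The exact coefficients solve the coefficient system\<close>

lemma expansion_fourier_coeff: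
  assumes "hankel_expansion k R \<phi> c" "r > R"
  shows "integral {0..2 * pi} (\<lambda>\<theta>. \<phi> (polar_pt r \<theta>) * cis (- (of_int n * \<theta>)))
           = of_real (2 * pi) * (beta k R n r * c n)"
proof (rule fourier_coefficient_of_has_sum)
  show "((\<lambda>n. beta k R n r * c n * cis (of_int n * \<theta>)) has_sum \<phi> (polar_pt r \<theta>)) UNIV" for \<theta>
    using assms by (simp add: hankel_expansion_def beta_def exp_i_eq_cis)
qed

text \<open>Integration by parts over a full period: the boundary terms cancel, and differentiating the
  exponential produces the factor \<open>\<i>n\<close>.\<close>

lemma fourier_coeff_angular_slope:
  assumes C2: "C2_on {x. norm x > a} \<phi>" "a \<ge> 0" "r > a" and "hankel_expansion k R \<phi> c" "r > R"
  shows "fourier_coeff (angular_slope \<phi> r) n = \<i> * of_int n * beta k R n r * c n"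
proof -
  let ?e = "\<lambda>\<theta>. cis (- (of_int n * \<theta>))" and ?e' = "\<lambda>\<theta>. - \<i> * of_int n * cis (- (of_int n * \<theta>))"
  let ?\<phi> = "\<lambda>\<theta>. \<phi> (polar_pt r \<theta>)"
  have per: "?\<phi> (2 * pi) = ?\<phi> 0" "?e (2 * pi) = ?e 0"
    using cis_multiple_2pi[of "- real_of_int n"] by (simp_all add: polar_pt_def mult_ac)
  have int: "(\<lambda>\<theta>. ?\<phi> \<theta> * ?e \<theta>) integrable_on {0..2 * pi}"
    by (intro integrable_continuous_interval continuous_intros continuous_on_circle_of_C2[OF C2])
  have "((\<lambda>\<theta>. (- \<i> * of_int n) * (?\<phi> \<theta> * ?e \<theta>)) has_integral
          (- \<i> * of_int n) * (of_real (2 * pi) * (beta k R n r * c n))) {0..2 * pi}"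
    using integrable_integral[OF int] expansion_fourier_coeff[OF assms(4,5), of n]
    by (intro has_integral_mult_right) simp
  hence "((\<lambda>\<theta>. ?\<phi> \<theta> * ?e' \<theta>) has_integral ?\<phi> (2 * pi) * ?e (2 * pi) - ?\<phi> 0 * ?e 0
          - \<i> * of_int n * of_real (2 * pi) * beta k R n r * c n) {0..2 * pi}"
    unfolding per by (simp add: mult_ac)
  hence "((\<lambda>\<theta>. angular_slope \<phi> r \<theta> * ?e \<theta>) has_integral
          \<i> * of_int n * of_real (2 * pi) * beta k R n r * c n) {0..2 * pi}"
  proof (rule integration_by_parts[OF bounded_bilinear_mult, rotated 5])
    show "(?\<phi> has_vector_derivative angular_slope \<phi> r \<theta>) (at \<theta>)" for \<theta>
      by (rule angular_slope_has_derivative[OF polar_pt_differentiable[OF C2]])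
    show "(?e has_vector_derivative ?e' \<theta>) (at \<theta>)" for \<theta>
      using cis_has_vector_derivative[of "- of_int n" \<theta>] by simp
  qed (auto intro!: continuous_intros continuous_on_circle_of_C2[OF C2])
  thus ?thesis
    by (simp add: fourier_coeff_continuous continuous_on_slopes_circle[OF C2] integral_unique)
qed

text \<open>Differentiation under the integral sign shows that the \<open>n\<close>-th Fourier coefficient of \<open>\<partial>\<^sub>r \<phi>\<close> is the
  \<open>r\<close>-derivative of the \<open>n\<close>-th Fourier coefficient \<open>\<beta>\<^sub>n(r) c\<^sub>n\<close> of \<open>\<phi>\<close>, and \<open>\<beta>\<^sub>n' = \<alpha>\<^sub>n\<close>.\<close>

lemma fourier_coeff_radial_slope:
  assumes C2: "C2_on {x. norm x > a} \<phi>" "a \<ge> 0" "r > a" and "hankel_expansion k R \<phi> c" "R \<le> a" "k > 0"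
  shows "fourier_coeff (radial_slope \<phi> r) n = alpha k R n r * c n"
proof -
  let ?I = "\<lambda>r. integral (cbox 0 (2 * pi)) (\<lambda>\<theta>. \<phi> (polar_pt r \<theta>) * cis (- (of_int n * \<theta>)))"
  have "(?I has_vector_derivative
         integral (cbox 0 (2 * pi)) (\<lambda>\<theta>. radial_slope \<phi> r \<theta> * cis (- (of_int n * \<theta>)))) (at r within {a<..})"
  proof (rule leibniz_rule_vector_derivative)
    fix s \<theta> :: real assume s: "s \<in> {a<..}"
    have "((\<lambda>r. \<phi> (polar_pt r \<theta>)) has_vector_derivative radial_slope \<phi> s \<theta>) (at s)"
      using s by (intro radial_slope_has_derivative polar_pt_differentiable[OF C2(1,2)]) auto
    thus "((\<lambda>r. \<phi> (polar_pt r \<theta>) * cis (- (of_int n * \<theta>))) has_vector_derivative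
            radial_slope \<phi> s \<theta> * cis (- (of_int n * \<theta>))) (at s within {a<..})"
      by (rule has_vector_derivative_at_within[OF has_vector_derivative_mult_left])
  next
    fix s :: real assume s: "s \<in> {a<..}"
    show "(\<lambda>\<theta>. \<phi> (polar_pt s \<theta>) * cis (- (of_int n * \<theta>))) integrable_on cbox 0 (2 * pi)"
      using s unfolding cbox_interval
      by (intro integrable_continuous_interval continuous_intros continuous_on_circle_of_C2[OF C2(1,2)]) auto
  next
    show "continuous_on ({a<..} \<times> cbox 0 (2 * pi)) (\<lambda>(r, \<theta>). radial_slope \<phi> r \<theta> * cis (- (of_int n * \<theta>)))"
      using continuous_on_slopes(1)[OF C2(1,2), of "{a<..} \<times> cbox 0 (2 * pi)"]
      unfolding case_prod_beta by (intro continuous_intros) auto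
  qed (use C2 in auto)
  hence "(?I has_vector_derivative
         integral {0..2 * pi} (\<lambda>\<theta>. radial_slope \<phi> r \<theta> * cis (- (of_int n * \<theta>)))) (at r)"
    using C2(3) at_within_open[of r "{a<..}"] by (simp only: greaterThan_iff open_greaterThan cbox_interval)
  moreover have "(?I has_vector_derivative of_real (2 * pi) * (alpha k R n r * c n)) (at r)"
  proof (rule has_vector_derivative_transform_within_open)
    have "((\<lambda>r. (of_real (2 * pi) / hankel1 n (of_real (k * R)) * c n) * hankel1 n (of_real (k * r)))
        has_vector_derivative (of_real (2 * pi) / hankel1 n (of_real (k * R)) * c n)
          * (of_real k * deriv (hankel1 n) (of_real (k * r)))) (at r)"
      using C2 assms(6) by (intro has_vector_derivative_mult_right hankel1_has_derivative_of_real) auto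
    thus "((\<lambda>r. of_real (2 * pi) * (beta k R n r * c n)) has_vector_derivative
           of_real (2 * pi) * (alpha k R n r * c n)) (at r)"
      by (simp add: beta_def alpha_def mult_ac)
    show "of_real (2 * pi) * (beta k R n s * c n) = ?I s" if "s \<in> {a<..}" for s
      using that assms(5) by (simp only: expansion_fourier_coeff[OF assms(4)] cbox_interval greaterThan_iff)
  qed (use C2 in auto)
  ultimately have "integral {0..2 * pi} (\<lambda>\<theta>. radial_slope \<phi> r \<theta> * cis (- (of_int n * \<theta>)))
      = of_real (2 * pi) * (alpha k R n r * c n)"
    by (rule vector_derivative_unique_at)
  thus ?thesis
    by (simp add: fourier_coeff_continuous continuous_on_slopes_circle[OF C2])
qed

lemma fourier_coeff_helmholtz:
  assumes \<phi>p: "C2_on {x. norm x > a} \<phi>p" and \<phi>s: "C2_on {x. norm x > a} \<phi>s"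
    and v: "\<And>x. norm x > a \<Longrightarrow> v x = grad \<phi>p x + curl_pol \<phi>s x"
    and exp: "hankel_expansion kp R \<phi>p cp" "hankel_expansion ks R \<phi>s cs"
    and pos: "kp > 0" "ks > 0" "a \<ge> 0" "R \<le> a" "r > a"
  shows "fourier_coeff (\<lambda>\<theta>. dot_cnj (v (polar_pt r \<theta>)) (e_r \<theta>)) n
           = alpha kp R n r * cp n + \<i> * of_int n / of_real r * beta ks R n r * cs n"
    and "fourier_coeff (\<lambda>\<theta>. dot_cnj (v (polar_pt r \<theta>)) (e_theta \<theta>)) n
           = \<i> * of_int n / of_real r * beta kp R n r * cp n - alpha ks R n r * cs n"
proof -
  have r: "r > 0" "r > R" using pos by auto
  have comps: "dot_cnj (v (polar_pt r \<theta>)) (e_r \<theta>) = radial_slope \<phi>p r \<theta> + angular_slope \<phi>s r \<theta> / of_real r"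
       "dot_cnj (v (polar_pt r \<theta>)) (e_theta \<theta>) = angular_slope \<phi>p r \<theta> / of_real r - radial_slope \<phi>s r \<theta>" for \<theta>
    using pos r v[of "polar_pt r \<theta>"]
    by (intro helmholtz_polar_components polar_pt_differentiable[OF \<phi>s] v; simp add: norm_polar_pt)+
  have int: "integrable period_measure (radial_slope \<phi> r)"
            "integrable period_measure (\<lambda>\<theta>. angular_slope \<phi> r \<theta> / of_real r)"
    if "C2_on {x. norm x > a} \<phi>" for \<phi>
    using continuous_on_slopes_circle[OF that pos(3,5)] r
    by (auto intro!: continuous_imp_integrable_real continuous_intros)
  show "fourier_coeff (\<lambda>\<theta>. dot_cnj (v (polar_pt r \<theta>)) (e_r \<theta>)) n
           = alpha kp R n r * cp n + \<i> * of_int n / of_real r * beta ks R n r * cs n"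
    unfolding comps fourier_coeff_add[OF int(1)[OF \<phi>p] int(2)[OF \<phi>s]] fourier_coeff_divide
      fourier_coeff_radial_slope[OF \<phi>p pos(3,5) exp(1) pos(4,1)]
      fourier_coeff_angular_slope[OF \<phi>s pos(3,5) exp(2) r(2)] by simp
  show "fourier_coeff (\<lambda>\<theta>. dot_cnj (v (polar_pt r \<theta>)) (e_theta \<theta>)) n
           = \<i> * of_int n / of_real r * beta kp R n r * cp n - alpha ks R n r * cs n"
    unfolding comps fourier_coeff_diff[OF int(2)[OF \<phi>p] int(1)[OF \<phi>s]] fourier_coeff_divide
      fourier_coeff_radial_slope[OF \<phi>s pos(3,5) exp(2) pos(4,2)]
      fourier_coeff_angular_slope[OF \<phi>p pos(3,5) exp(1) r(2)] by simp
qed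

lemma continuous_on_fourier_coeff_param:
  assumes "continuous_on ({a..b} \<times> {0..2 * pi}) (\<lambda>(r, \<theta>). g r \<theta>)"
  shows "continuous_on {a..b} (\<lambda>r. fourier_coeff (g r) n)"
proof -
  have "continuous_on {a..b} (\<lambda>r. integral (cbox 0 (2 * pi)) (\<lambda>\<theta>. g r \<theta> * cis (- (of_int n * \<theta>))))"
    using assms unfolding case_prod_beta
    by (intro integral_continuous_on_param) (auto simp: case_prod_beta intro!: continuous_intros)
  hence "continuous_on {a..b} (\<lambda>r. integral {0..2 * pi} (\<lambda>\<theta>. g r \<theta> * cis (- (of_int n * \<theta>))) / of_real (2 * pi))"
    unfolding cbox_interval by (intro continuous_intros) auto
  moreover have "continuous_on {0..2 * pi} (g r)" if "r \<in> {a..b}" for r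
  proof -
    have "continuous_on {0..2 * pi} (\<lambda>\<theta>. (r, \<theta>))" by (intro continuous_intros)
    moreover have "(\<lambda>\<theta>. (r, \<theta>)) ` {0..2 * pi} \<subseteq> {a..b} \<times> {0..2 * pi}" using that by auto
    ultimately have "continuous_on {0..2 * pi} (\<lambda>\<theta>. case (r, \<theta>) of (r, \<theta>) \<Rightarrow> g r \<theta>)"
      by (rule continuous_on_compose2[OF assms])
    thus ?thesis by simp
  qed
  hence "fourier_coeff (g r) n = integral {0..2 * pi} (\<lambda>\<theta>. g r \<theta> * cis (- (of_int n * \<theta>))) / of_real (2 * pi)"
    if "r \<in> {a..b}" for r
    using that by (intro fourier_coeff_continuous) auto
  ultimately show ?thesis
    by (simp cong: continuous_on_cong_simp)
qed

lemma continuous_on_polar_component: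
  assumes "continuous_on {x. norm x \<ge> \<rho>} v" "\<rho> > 0" "e = e_r \<or> e = e_theta" "S \<subseteq> {\<rho>..} \<times> UNIV"
  shows "continuous_on S (\<lambda>(r, \<theta>). dot_cnj (v (polar_pt r \<theta>)) (e \<theta>))"
proof -
  have img: "(\<lambda>p. polar_pt (fst p) (snd p)) ` S \<subseteq> {x. norm x \<ge> \<rho>}"
    using assms(2,4) by (force simp: norm_polar_pt subset_iff)
  have v: "continuous_on S (\<lambda>p. v (polar_pt (fst p) (snd p)))"
    by (rule continuous_on_compose2[OF assms(1) continuous_on_polar_pt img]) (intro continuous_intros)+
  have "continuous_on UNIV e"
    using assms(3) continuous_on_e_r continuous_on_e_theta by auto
  hence e: "continuous_on S (\<lambda>p. e (snd p))"
    by (rule continuous_on_compose2) (auto intro!: continuous_intros)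
  show ?thesis
    unfolding dot_cnj_def case_prod_beta by (intro continuous_intros v e)
qed

text \<open>The system holds on each circle of radius \<open>r > \<rho>\<close>, where the potentials are smooth.  Its data side
  is continuous on \<open>r \<ge> \<rho>\<close> because \<open>v\<close> is, its coefficient side because the Hankel functions are
  holomorphic; so it persists at \<open>r = \<rho>\<close>, a circle on which the potentials are not assumed
  differentiable.\<close>

lemma coefficient_system_of_helmholtz:
  assumes \<phi>p: "C2_on {x. norm x > \<rho>} \<phi>p" and \<phi>s: "C2_on {x. norm x > \<rho>} \<phi>s"
    and v: "\<And>x. norm x > \<rho> \<Longrightarrow> v x = grad \<phi>p x + curl_pol \<phi>s x"
    and cont: "continuous_on {x. norm x \<ge> \<rho>} v"
    and exp: "hankel_expansion kp R \<phi>p cp" "hankel_expansion ks R \<phi>s cs"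
    and pos: "kp > 0" "ks > 0" "\<rho> > 0" "R \<le> \<rho>"
  shows "coefficient_system kp ks R \<rho> v cp cs"
proof -
  have limit: "f \<rho> = g \<rho>"
    if "continuous_on {\<rho>..\<rho> + 1} f" "continuous_on {\<rho>..\<rho> + 1} g" "\<And>r. r > \<rho> \<Longrightarrow> f r = g r"
    for f g :: "real \<Rightarrow> complex"
  proof -
    have "f \<rho> - g \<rho> = 0"
      by (rule continuous_constant_on_closure[where S = "{\<rho><..<\<rho> + 1}"])
        (use that in \<open>auto intro!: continuous_intros\<close>)
    thus ?thesis by simp
  qed
  have data: "continuous_on {\<rho>..\<rho> + 1} (\<lambda>r. fourier_coeff (\<lambda>\<theta>. dot_cnj (v (polar_pt r \<theta>)) (e \<theta>)) n)"
    if "e = e_r \<or> e = e_theta" for e n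
    by (intro continuous_on_fourier_coeff_param continuous_on_polar_component[OF cont pos(3) that]) auto
  have sub: "{\<rho>..\<rho> + 1} \<subseteq> {0<..}" using pos by auto
  note helm = fourier_coeff_helmholtz[OF \<phi>p \<phi>s v exp pos(1,2) less_imp_le[OF pos(3)] pos(4)]
  note ab = continuous_on_alpha_beta[OF pos(1) sub] continuous_on_alpha_beta[OF pos(2) sub]
  have "fourier_coeff (\<lambda>\<theta>. dot_cnj (v (polar_pt \<rho> \<theta>)) (e_r \<theta>)) n
           = alpha kp R n \<rho> * cp n + \<i> * of_int n / of_real \<rho> * beta ks R n \<rho> * cs n" for n
    by (rule limit[OF data _ helm(1)]) (use pos in \<open>auto intro!: continuous_intros ab\<close>)
  moreover have "fourier_coeff (\<lambda>\<theta>. dot_cnj (v (polar_pt \<rho> \<theta>)) (e_theta \<theta>)) n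
           = \<i> * of_int n / of_real \<rho> * beta kp R n \<rho> * cp n - alpha ks R n \<rho> * cs n" for n
    by (rule limit[OF data _ helm(2)]) (use pos in \<open>auto intro!: continuous_intros ab\<close>)
  ultimately show ?thesis
    by (simp add: coefficient_system_def f_p_eq_fourier_coeff[OF pos(3)] f_s_eq_fourier_coeff[OF pos(3)])
qed

section \<open>The noise estimate\<close>

lemma L2_norm_circle_nonneg: "\<rho> \<ge> 0 \<Longrightarrow> L2_norm_circle \<rho> w \<ge> 0"
  by (simp add: L2_norm_circle_def circle_integral_def)

lemma C2_on_subset: "C2_on S f \<Longrightarrow> T \<subseteq> S \<Longrightarrow> C2_on T f"
  unfolding C2_on_def by (blast intro: continuous_on_subset)

theorem theorem2:
  fixes lam mu \<omega> \<rho> R :: real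
    and D :: "(real^2) set" and z p :: "real^2"
    and v :: "real^2 \<Rightarrow> complex^2"
    and \<phi>p \<phi>s :: "real^2 \<Rightarrow> complex"
    and cp cs :: "int \<Rightarrow> complex"
  assumes "mu > 0" and "lam + mu > 0" and "\<omega> > 0" and "\<rho> > 0"
    and "obstacle \<rho> D"
    and "z \<in> sphere 0 \<rho>" and "norm p = 1"
    and "scattered_field lam mu \<omega> D z p v"
    and "radiating_potential (k_p lam mu \<omega>) D \<phi>p"
    and "radiating_potential (k_s mu \<omega>) D \<phi>s"
    and "\<And>x. x \<notin> closure D \<Longrightarrow> v x = grad \<phi>p x + curl_pol \<phi>s x"
    and "R > 0" and "ball 0 R \<subseteq> D"
    and "hankel_expansion (k_p lam mu \<omega>) R \<phi>p cp"
    and "hankel_expansion (k_s mu \<omega>) R \<phi>s cs"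
    and "\<And>n. hankel1 n (of_real (k_p lam mu \<omega> * \<rho>)) \<noteq> 0"
    and "\<And>n. hankel1 n (of_real (k_s mu \<omega> * \<rho>)) \<noteq> 0"
  shows "\<exists>C3 > 0. \<exists>C4 > 0. \<forall>\<delta> v\<delta> cp\<delta> cs\<delta>. \<forall>N::nat.
    0 < \<delta> \<and> \<delta> < 1 \<and> L2_circle \<rho> v\<delta> \<and>
    L2_norm_circle \<rho> (\<lambda>x. v x - v\<delta> x) \<le> \<delta> * L2_norm_circle \<rho> v \<and>
    coefficient_system (k_p lam mu \<omega>) (k_s mu \<omega>) R \<rho> v\<delta> cp\<delta> cs\<delta> \<and>
    real N \<ge> 4 * k_s mu \<omega> * \<rho> + 1 \<longrightarrow>
    (L2_norm_circle \<rho> (\<lambda>x. truncated_field (k_p lam mu \<omega>) (k_s mu \<omega>) R cp cs N x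
        - truncated_field (k_p lam mu \<omega>) (k_s mu \<omega>) R cp\<delta> cs\<delta> N x))\<^sup>2
      \<le> C3 * \<delta>\<^sup>2 + C4 * real N ^ 5 * \<delta>\<^sup>2"
proof -
  define kp ks where "kp = k_p lam mu \<omega>" and "ks = k_s mu \<omega>"
  have pos: "kp > 0" "ks > 0"
    using assms(1-3) by (simp_all add: kp_def ks_def k_p_def k_s_def)
  have D: "D \<subseteq> ball 0 \<rho>"
    using assms(5) by (simp add: obstacle_def)
  hence "closure D \<subseteq> cball 0 \<rho>"
    by (intro closure_minimal) auto
  hence out: "{x. norm x > \<rho>} \<subseteq> - closure D"
    by force
  have "ball 0 R \<subseteq> ball (0 :: real^2) \<rho>"
    using assms(13) D by simp
  hence R: "R \<le> \<rho>"
    using assms(12) by (simp add: ball_subset_ball_iff)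
  have "{x. norm x \<ge> \<rho>} \<subseteq> - D"
    using D by force
  hence cont: "continuous_on {x. norm x \<ge> \<rho>} v"
    using assms(8) continuous_on_subset by (auto simp: scattered_field_def)
  have C2: "C2_on {x. norm x > \<rho>} \<phi>p" "C2_on {x. norm x > \<rho>} \<phi>s"
    using assms(9,10) out by (auto simp: radiating_potential_def intro: C2_on_subset)
  have sys: "coefficient_system kp ks R \<rho> v cp cs"
    using out assms(11,14,15) pos \<open>\<rho> > 0\<close> R
    by (intro coefficient_system_of_helmholtz[OF C2 _ cont]) (auto simp: kp_def ks_def)
  have L2: "L2_circle \<rho> v"
    by (rule L2_circle_continuous[OF cont \<open>\<rho> > 0\<close>])
  define C where "C = (L2_norm_circle \<rho> v)\<^sup>2"
  have bound: "(L2_norm_circle \<rho> (\<lambda>x. truncated_field kp ks R cp cs N x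
        - truncated_field kp ks R cp\<delta> cs\<delta> N x))\<^sup>2 \<le> (C + 1) * \<delta>\<^sup>2 + 1 * real N ^ 5 * \<delta>\<^sup>2"
    if data: "L2_circle \<rho> v\<delta>" "L2_norm_circle \<rho> (\<lambda>x. v x - v\<delta> x) \<le> \<delta> * L2_norm_circle \<rho> v"
      "coefficient_system kp ks R \<rho> v\<delta> cp\<delta> cs\<delta>"
    for \<delta> v\<delta> cp\<delta> cs\<delta> N
  proof -
    have "L2_norm_circle \<rho> (\<lambda>x. truncated_field kp ks R cp cs N x
        - truncated_field kp ks R cp\<delta> cs\<delta> N x) \<le> \<delta> * L2_norm_circle \<rho> v"
      using truncated_field_stability[OF \<open>\<rho> > 0\<close> L2 data(1) sys data(3), of N] data(2) by linarith
    hence "(L2_norm_circle \<rho> (\<lambda>x. truncated_field kp ks R cp cs N x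
        - truncated_field kp ks R cp\<delta> cs\<delta> N x))\<^sup>2 \<le> (\<delta> * L2_norm_circle \<rho> v)\<^sup>2"
      using \<open>\<rho> > 0\<close> by (intro power_mono L2_norm_circle_nonneg) auto
    also have "\<dots> = C * \<delta>\<^sup>2"
      by (simp add: C_def power_mult_distrib mult.commute)
    also have "\<dots> \<le> C * \<delta>\<^sup>2 + (\<delta>\<^sup>2 + real N ^ 5 * \<delta>\<^sup>2)"
      by simp
    finally show ?thesis
      by (simp add: ring_distribs)
  qed
  \<comment> \<open>The summand \<open>1\<close> keeps the first constant positive when \<open>v\<close> vanishes on the circle.\<close>
  have "C + 1 > 0" "(1 :: real) > 0"
    by (simp_all add: C_def add_nonneg_pos)
  thus ?thesis
    using bound unfolding kp_def ks_def by blast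
qed

end
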